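(* Let $d,\kappa$ be positive integers and $k$ an integer such that $k>2\kappa$. Let $\varphi:[-1,1]\times[0,\infty)\to\mathbb{R}$ be a function in $\mathcal{P}(\mathbb{S}^d\times\mathbb{R}^k)$ for which $I_2^\kappa\varphi$ is defined, let $F_n$ be the $k$-Schoenberg measures of the $d$-Schoenberg functions of $\varphi$, and put $$g_n^\nu(t):=\int_0^\infty\Omega_{k-2\nu}(tr)\,\frac1{r^{2\nu}}\,dF_n(r),\qquad t\in[0,\infty),\ n\ge0,\ 1\le\nu\le\kappa.$$ Suppose that (i) $g_n^\nu(0)=\displaystyle\int_0^\infty\frac1{r^{2\nu}}\,dF_n(r)<\infty$ for all $n\ge0$ and $\nu\in\{1,2,\dots,\kappa\}$; (ii) $0\ne\displaystyle\sum_{n=0}^\infty g_n^\nu(0)\,C_n^{(d-1)/2}(1)<\infty$ for $\nu\in\{1,2,\dots,\kappa\}$. Then $I_2^\kappa\varphi$ has the Gegenbauer series representation $$I_2^\kappa\varphi(x,t)=\frac1{\sum_{n=0}^\infty g_n^\kappa(0)\,C_n^{(d-1)/2}(1)}\sum_{n=0}^\infty g_n^\kappa(t)\,C_n^{(d-1)/2}(x),\qquad (x,t)\in[-1,1]\times[0,\infty).$$ Moreover, $I_2^\kappa\varphi$ belongs to $\mathcal{P}(\mathbb{S}^d\times\mathbb{R}^{k-2\kappa})$.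
   Context: $\mathbb{S}^d$ is the unit sphere of $\mathbb{R}^{d+1}$, with geodesic distance $\theta(x,x')=\arccos\langle x,x'\rangle$; $\|\cdot\|$ is the Euclidean norm on $\mathbb{R}^k$. A function $C:Z\times Z\to\mathbb{R}$ is positive definite if $\sum_{i,j=1}^N a_i\,C(z_i,z_j)\,a_j\ge 0$ for all finite systems of reals $a_i$ and points $z_i\in Z$. $\mathcal{P}(\mathbb{S}^d\times\mathbb{R}^k)$ is the class of continuous $\varphi:[-1,1]\times[0,\infty)\to\mathbb{R}$ such that $C((x,y),(x',y'))=\varphi(\cos\theta(x,x'),\|y-y'\|)$ is positive definite on $\mathbb{S}^d\times\mathbb{R}^k$. $\mathcal{P}(\mathbb{R}^k)$ is the class of continuous $f:[0,\infty)\to\mathbb{R}$ such that $f(\|y-y'\|)$ is positive definite on $\mathbb{R}^k$. $C_n^\lambda$ are the (unnormalized) Gegenbauer polynomials: for $\lambda>0$, $\sum_n C_n^\lambda(x)s^n=(1-2xs+s^2)^{-\lambda}$; for $\lambda=0$, $C_0^0=1$ and $C_n^0(\cos\theta)=\frac2n\cos(n\theta)$, $n\ge1$. Known facts used as definitions: $\varphi\in\mathcal{P}(\mathbb{S}^d\times\mathbb{R}^k)$ if and only if it has a (unique, uniformly convergent) expansion $\varphi(x,t)=\sum_{n=0}^\infty f_n^d(t)C_n^{(d-1)/2}(x)$ with $f_n^d\in\mathcal{P}(\mathbb{R}^k)$ and $\sum_n f_n^d(0)C_n^{(d-1)/2}(1)<\infty$. The $f_n^d$ are the $d$-Schoenberg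 functions of $\varphi$. Each has a unique representation $f_n^d(t)=\int_0^\infty\Omega_k(tr)\,dF_n(r)$ with $F_n$ a nonnegative bounded measure on $[0,\infty)$, the $k$-Schoenberg measure of $f_n^d$. Here $\Omega_k(t)=\Gamma(k/2)(2/t)^{(k-2)/2}J_{(k-2)/2}(t)$ for $t>0$, $\Omega_k(0)=1$, with $J_\nu$ the Bessel function of the first kind. The integrand $1/r^{2\nu}$ is $+\infty$ at $r=0$. The operator $I_2$: $$I_2\varphi(x,t):=\frac{\int_t^\infty v\,\varphi(x,v)\,dv}{\int_0^\infty v\,\varphi(1,v)\,dv},\qquad (x,t)\in[-1,1]\times[0,\infty),$$ defined when $v\mapsto v\varphi(1,v)$ is integrable over $[0,\infty)$, the denominator is nonzero, and the integrals in the numerator exist. $I_2^0\varphi:=\varphi$ and $I_2^\kappa\varphi:=I_2(I_2^{\kappa-1}\varphi)$; "$I_2^\kappa\varphi$ is defined" means that these conditions hold for $I_2^{\nu-1}\varphi$ in place of $\varphi$, for every $\nu=1,\dots,\kappa$. *)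

theory Defs
  imports "HOL-Analysis.Analysis" "HOL-Computational_Algebra.Formal_Power_Series"
begin

text \<open>
  The dimensions \<open>d\<close> and \<open>k\<close> are natural numbers, since \<open>\<real>\<^sup>k\<close> and
  \<open>\<real>\<^sup>k\<^sup>-\<^sup>2\<^sup>\<kappa>\<close> occur side by side. So \<open>\<real>\<^sup>k\<close> is the set of extensional functions on
  \<open>{..<k}\<close>, and its Euclidean norm is \<open>L2_set\<close> over \<open>{..<k}\<close>. Functions on
  \<open>[-1,1] \<times> [0,\<infinity>)\<close> or on \<open>[0,\<infinity>)\<close> are total functions on the reals of which only the values
  on these domains are ever used.
\<close>

definition euclid :: "nat \<Rightarrow> (nat \<Rightarrow> real) set" where
  "euclid k = {..<k} \<rightarrow>\<^sub>E UNIV"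

definition unit_sphere :: "nat \<Rightarrow> (nat \<Rightarrow> real) set" where
  "unit_sphere d = {x \<in> euclid (d + 1). L2_set x {..<d + 1} = 1}"

definition geodesic_dist :: "nat \<Rightarrow> (nat \<Rightarrow> real) \<Rightarrow> (nat \<Rightarrow> real) \<Rightarrow> real" where
  "geodesic_dist d x x' = arccos (\<Sum>i<d + 1. x i * x' i)"

definition positive_definite_on :: "'z set \<Rightarrow> ('z \<Rightarrow> 'z \<Rightarrow> real) \<Rightarrow> bool" where
  "positive_definite_on Z C \<longleftrightarrow>
     (\<forall>(N::nat) (a::nat \<Rightarrow> real) (z::nat \<Rightarrow> 'z). (\<forall>i<N. z i \<in> Z) \<longrightarrow>
        (\<Sum>i<N. \<Sum>j<N. a i * C (z i) (z j) * a j) \<ge> 0)"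

definition pd_sphere_euclid :: "nat \<Rightarrow> nat \<Rightarrow> (real \<Rightarrow> real \<Rightarrow> real) set" where
  "pd_sphere_euclid d k =
     {\<phi>. continuous_on ({-1..1} \<times> {0..}) (\<lambda>(x, t). \<phi> x t) \<and>
         positive_definite_on (unit_sphere d \<times> euclid k)
           (\<lambda>(x, y) (x', y').
              \<phi> (cos (geodesic_dist d x x')) (L2_set (\<lambda>i. y i - y' i) {..<k}))}"

definition pd_euclid :: "nat \<Rightarrow> (real \<Rightarrow> real) set" where
  "pd_euclid k =
     {f. continuous_on {0..} f \<and>
         positive_definite_on (euclid k) (\<lambda>y y'. f (L2_set (\<lambda>i. y i - y' i) {..<k}))}"

text \<open>
  For \<open>\<lambda> > 0\<close>, the coefficient of \<open>s\<^sup>n\<close> in \<open>(1 - 2xs + s\<^sup>2)\<close> to the power \<open>-\<lambda>\<close>, where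
  \<open>fps_binomial a\<close> is the series of \<open>(1 + X)\<close> to the power \<open>a\<close>. The arguments are
  \<open>\<lambda>\<close>, \<open>n\<close>, \<open>x\<close>; for \<open>\<lambda> = 0\<close> only \<open>x \<in> [-1,1]\<close> is meaningful.
\<close>

definition gegenbauer :: "real \<Rightarrow> nat \<Rightarrow> real \<Rightarrow> real" where
  "gegenbauer lam n x =
     (if lam = 0 then (if n = 0 then 1 else 2 / real n * cos (real n * arccos x))
      else fps_nth (fps_binomial (- lam) oo (fps_const (- 2 * x) * fps_X + fps_X ^ 2)) n)"

text \<open>
  Bessel function of the first kind for \<open>t > 0\<close>. With \<open>rGamma = 1/\<Gamma>\<close> the terms at poles of
  \<open>\<Gamma>\<close> vanish.
\<close>

definition bessel_J :: "real \<Rightarrow> real \<Rightarrow> real" where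
  "bessel_J \<nu> t =
     (\<Sum>m. (-1) ^ m / fact m * rGamma (real m + \<nu> + 1) * (t / 2) powr (2 * real m + \<nu>))"

definition Omega :: "nat \<Rightarrow> real \<Rightarrow> real" where
  "Omega k t =
     (if t = 0 then 1
      else Gamma (real k / 2) * (2 / t) powr ((real k - 2) / 2) * bessel_J ((real k - 2) / 2) t)"

definition schoenberg_functions ::
    "nat \<Rightarrow> nat \<Rightarrow> (real \<Rightarrow> real \<Rightarrow> real) \<Rightarrow> (nat \<Rightarrow> real \<Rightarrow> real) \<Rightarrow> bool" where
  "schoenberg_functions d k \<phi> f \<longleftrightarrow>
     (\<forall>n. f n \<in> pd_euclid k) \<and>
     summable (\<lambda>n. f n 0 * gegenbauer ((real d - 1) / 2) n 1) \<and>
     uniform_limit ({-1..1} \<times> {0..})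
       (\<lambda>N (x, t). \<Sum>n<N. f n t * gegenbauer ((real d - 1) / 2) n x)
       (\<lambda>(x, t). \<phi> x t) sequentially"

definition schoenberg_measure :: "nat \<Rightarrow> (real \<Rightarrow> real) \<Rightarrow> real measure \<Rightarrow> bool" where
  "schoenberg_measure k f F \<longleftrightarrow>
     finite_measure F \<and> sets F = sets (restrict_space borel {0..}) \<and>
     (\<forall>t\<ge>0. f t = (\<integral>r. Omega k (t * r) \<partial>F))"

definition I2 :: "(real \<Rightarrow> real \<Rightarrow> real) \<Rightarrow> real \<Rightarrow> real \<Rightarrow> real" where
  "I2 \<phi> x t = (LINT v:{t..}|lborel. v * \<phi> x v) / (LINT v:{0..}|lborel. v * \<phi> 1 v)"

definition I2_defined :: "(real \<Rightarrow> real \<Rightarrow> real) \<Rightarrow> bool" where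
  "I2_defined \<phi> \<longleftrightarrow>
     set_integrable lborel {0..} (\<lambda>v. v * \<phi> 1 v) \<and>
     (LINT v:{0..}|lborel. v * \<phi> 1 v) \<noteq> 0 \<and>
     (\<forall>x\<in>{-1..1}. \<forall>t\<ge>0. set_integrable lborel {t..} (\<lambda>v. v * \<phi> x v))"

definition I2_power_defined :: "nat \<Rightarrow> (real \<Rightarrow> real \<Rightarrow> real) \<Rightarrow> bool" where
  "I2_power_defined \<kappa> \<phi> \<longleftrightarrow> (\<forall>\<nu>\<in>{1..\<kappa>}. I2_defined ((I2 ^^ (\<nu> - 1)) \<phi>))"

text \<open>
  \<open>neg_moment F \<nu>\<close> is taken in \<open>ennreal\<close>, where \<open>1 / 0 = \<infinity>\<close>; its finiteness includes
  \<open>F {0} = 0\<close>. Then the value \<open>1 / 0 = 0\<close> of the real integrand in \<open>g_fun\<close> at \<open>r = 0\<close> is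
  irrelevant, and \<open>g_fun k F \<nu> 0\<close> is the real value of \<open>neg_moment F \<nu>\<close>, as
  \<open>Omega _ 0 = 1\<close>.
\<close>

definition neg_moment :: "real measure \<Rightarrow> nat \<Rightarrow> ennreal" where
  "neg_moment F \<nu> = (\<integral>\<^sup>+r. 1 / ennreal (r ^ (2 * \<nu>)) \<partial>F)"

definition g_fun :: "nat \<Rightarrow> real measure \<Rightarrow> nat \<Rightarrow> real \<Rightarrow> real" where
  "g_fun k F \<nu> t = (\<integral>r. Omega (k - 2 * \<nu>) (t * r) * (1 / r ^ (2 * \<nu>)) \<partial>F)"

end

theory Submission
  imports Defs
begin

text \<open>
  Write \<open>f\<^sub>n(t) = \<integral> \<Omega>\<^sub>k(tr) dF\<^sub>n(r)\<close>. The functions \<open>\<Omega>\<^sub>m\<close> satisfy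
  \<open>\<Omega>\<^sub>m'(t) = -(t/m) \<Omega>\<^sub>m\<^sub>+\<^sub>2(t)\<close>, so that
  \<open>\<integral>\<^sub>t\<^sup>b v \<Omega>\<^sub>m\<^sub>+\<^sub>2(vr) dv = (m/r\<^sup>2) (\<Omega>\<^sub>m(tr) - \<Omega>\<^sub>m(br))\<close>.
  Put \<open>\<psi>\<^sub>\<nu>(x,t) = \<Sum>\<^sub>n g\<^sub>n\<^sup>\<nu>(t) C\<^sub>n(x)\<close>. Integrating this series term by term over \<open>[t,b]\<close> gives, with
  \<open>m = k - 2\<nu> - 2\<close>,
  \<open>\<integral>\<^sub>t\<^sup>b v \<psi>\<^sub>\<nu>(x,v) dv = m (\<psi>\<^sub>\<nu>\<^sub>+\<^sub>1(x,t) - \<psi>\<^sub>\<nu>\<^sub>+\<^sub>1(x,b))\<close>.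
  All interchanges are justified by \<open>|\<Omega>\<^sub>m| \<le> 1\<close> (an energy estimate for the Bessel equation) and
  \<open>|C\<^sub>n(x)| \<le> C\<^sub>n(1)\<close> (trivial for \<open>\<lambda> = 0\<close>; for \<open>\<lambda> > 0\<close> the coefficients of \<open>(1-s)\<close> to
  the power \<open>-\<lambda>\<close> are nonnegative, and the generating function is a product
  of two such binomial series in \<open>s e\<^sup>i\<^sup>\<theta>\<close> and its conjugate).

  It remains to let \<open>b\<close> tend to infinity. The integral converges because \<open>I\<^sub>2\<close> is assumed to be
  defined, so \<open>\<psi>\<^sub>\<nu>\<^sub>+\<^sub>1(x,b)\<close> has a limit \<open>L\<close>. For \<open>m = 1\<close> the function \<open>\<Omega>\<^sub>m\<close> is the cosine and has no
  limit at infinity, so \<open>L = 0\<close> cannot be read off term by term. But the mean of \<open>\<Omega>\<^sub>m(Ts)\<close> over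
  \<open>s \<in> [0,1]\<close> with weight \<open>m s\<^sup>m\<^sup>-\<^sup>1\<close> is \<open>\<Omega>\<^sub>m\<^sub>+\<^sub>2(T)\<close>, which is bounded by \<open>m/T\<close>. Hence the means of
  \<open>\<psi>\<^sub>\<nu>\<^sub>+\<^sub>1(x,\<cdot>)\<close> tend both to \<open>L\<close> and to \<open>0\<close> (\<open>omega_series_limit_unique\<close>). Therefore
  \<open>\<integral>\<^sub>t\<^sup>\<infinity> v \<psi>\<^sub>\<nu>(x,v) dv = m \<psi>\<^sub>\<nu>\<^sub>+\<^sub>1(x,t)\<close> (\<open>tail_integral_omega_series\<close>), and the expansion of
  \<open>I\<^sub>2\<close> follows by induction on \<open>\<nu>\<close>.

  The positive definiteness of \<open>I\<^sub>2\<phi>\<close> on the product with \<open>\<real>\<^sup>k\<^sup>-\<^sup>2\<close> does not need the series. In polar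
  coordinates \<open>2\<pi> \<integral>\<^sub>t\<^sup>\<infinity> v \<phi>(x,v) dv\<close> is the integral of \<open>\<phi>(x, sqrt(t\<^sup>2 + |z|\<^sup>2))\<close> over the plane, so up to
  a positive factor the kernel of \<open>I\<^sub>2\<phi>\<close> arises from that of \<open>\<phi>\<close> by integrating out two of the \<open>k\<close>
  coordinate differences. This preserves positive definiteness, since an integrable continuous
  positive definite function has nonnegative integral (\<open>positive_definite_integral_nonneg\<close>). The
  series is used once more for the continuity of \<open>I\<^sub>2\<phi>\<close> and the sign of the normalising factor.
\<close>

section \<open>A criterion for integrability on product spaces\<close>

lemma integrable_pair_bounded_by_product:
  fixes f :: "'a \<Rightarrow> 'b \<Rightarrow> real"
  assumes "sigma_finite_measure M1" "sigma_finite_measure M2"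
    and [measurable]: "case_prod f \<in> borel_measurable (M1 \<Otimes>\<^sub>M M2)"
    and g: "integrable M1 g" and h: "integrable M2 h"
    and le: "\<And>x y. x \<in> space M1 \<Longrightarrow> y \<in> space M2 \<Longrightarrow> \<bar>f x y\<bar> \<le> g x * h y"
  shows "integrable (M1 \<Otimes>\<^sub>M M2) (case_prod f)"
proof -
  interpret pair_sigma_finite M1 M2 using assms(1,2) by (simp add: pair_sigma_finite_def)
  have gh: "integrable M2 (\<lambda>y. g x * h y)" for x using h by simp
  have f_int: "integrable M2 (f x)" if "x \<in> space M1" for x
  proof (rule Bochner_Integration.integrable_bound[OF gh[of x]])
    show "AE y in M2. norm (f x y) \<le> norm (g x * h y)"
      using order_trans[OF le[OF that] abs_ge_self] unfolding real_norm_def by (intro AE_I2)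
    show "f x \<in> borel_measurable M2" using that by measurable
  qed
  show ?thesis
  proof (rule Fubini_integrable)
    have "norm (\<integral>y. norm (f x y) \<partial>M2) \<le> norm (g x * integral\<^sup>L M2 h)" if x: "x \<in> space M1" for x
    proof -
      have "0 \<le> (\<integral>y. norm (f x y) \<partial>M2)" by (intro integral_nonneg_AE) simp
      moreover have "(\<integral>y. norm (f x y) \<partial>M2) \<le> (\<integral>y. g x * h y \<partial>M2)"
        using le[OF x] by (intro integral_mono integrable_norm f_int x gh) simp
      moreover have "\<dots> = g x * integral\<^sup>L M2 h" by simp
      ultimately show ?thesis by simp
    qed
    hence "AE x in M1. norm (\<integral>y. norm (f x y) \<partial>M2) \<le> norm (g x * integral\<^sup>L M2 h)"
      by (rule AE_I2)
    moreover have "(\<lambda>x. \<integral>y. norm (f x y) \<partial>M2) \<in> borel_measurable M1" by measurable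
    ultimately have "integrable M1 (\<lambda>x. \<integral>y. norm (f x y) \<partial>M2)"
      using Bochner_Integration.integrable_bound[OF integrable_mult_left[OF g]] by blast
    thus "integrable M1 (\<lambda>x. \<integral>y. norm (case (x, y) of (x, y) \<Rightarrow> f x y) \<partial>M2)" by simp
    show "AE x in M1. integrable M2 (\<lambda>y. case (x, y) of (x, y) \<Rightarrow> f x y)"
      using f_int by simp
  qed measurable
qed

section \<open>Positive definite functions on Euclidean spaces\<close>

lemma positive_definite_on_finite_sum:
  assumes "positive_definite_on Z C" "finite I" "\<And>p. p \<in> I \<Longrightarrow> z p \<in> Z"
  shows "(\<Sum>p\<in>I. \<Sum>q\<in>I. a p * C (z p) (z q) * a q) \<ge> 0"
proof -
  obtain h where h: "bij_betw h {0..<card I} I"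
    using ex_bij_betw_nat_finite[OF assms(2)] by blast
  hence h': "bij_betw h {..<card I} I" by (simp add: lessThan_atLeast0)
  have "(\<Sum>p\<in>I. \<Sum>q\<in>I. a p * C (z p) (z q) * a q) =
      (\<Sum>i<card I. \<Sum>j<card I. (a \<circ> h) i * C ((z \<circ> h) i) ((z \<circ> h) j) * (a \<circ> h) j)"
    by (simp add: sum.reindex_bij_betw[OF h', symmetric])
  also have "\<dots> \<ge> 0"
    by (rule assms(1)[unfolded positive_definite_on_def, rule_format])
       (use assms(3) bij_betwE[OF h'] in auto)
  finally show ?thesis .
qed

text \<open>
  Sampling a function along a simple function turns its integral into a finite weighted sum. This
  is how positive definiteness, a statement on finite sums, is brought to bear on integrals.
\<close>

lemma integral_indicator_comp_simple_function:
  fixes s :: "'a::euclidean_space \<Rightarrow> 'a" and g :: "'a \<Rightarrow> real"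
  assumes s: "simple_function lborel s" and S: "S \<in> sets borel" "bounded S"
  shows "(\<integral>u. indicator S u * g (s u) \<partial>lborel) =
    (\<Sum>a\<in>range s. measure lborel (s -` {a} \<inter> S) * g a)"
proof -
  have fin: "finite (range s)" using simple_functionD(1)[OF s] by simp
  have meas: "s -` {a} \<inter> S \<in> sets lborel" for a
    using simple_functionD(2)[OF s, of "{a}"] S by auto
  have "emeasure lborel (s -` {a} \<inter> S) < \<infinity>" for a
    using S(2) by (intro emeasure_bounded_finite bounded_subset[OF S(2)]) auto
  hence int: "integrable lborel (\<lambda>u. indicator (s -` {a} \<inter> S) u * g a)" for a
    using meas by (intro integrable_mult_left integrable_real_indicator)
  have "indicator S u * g (s u) = (\<Sum>a\<in>range s. indicator (s -` {a} \<inter> S) u * g a)" for u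
  proof -
    have "(\<Sum>a\<in>range s. indicator (s -` {a} \<inter> S) u * g a) =
        (\<Sum>a\<in>range s. if a = s u then indicator S u * g (s u) else 0)"
      by (intro sum.cong) (auto simp: indicator_def)
    thus ?thesis using fin by simp
  qed
  thus ?thesis using int meas by (simp add: Bochner_Integration.integral_sum)
qed

lemma positive_definite_double_integral_nonneg:
  fixes K :: "'a::euclidean_space \<Rightarrow> real"
  assumes cont: "continuous_on UNIV K"
    and pd: "\<And>V b. finite V \<Longrightarrow> (\<Sum>u\<in>V. \<Sum>w\<in>V. b u * K (u - w) * b w) \<ge> 0"
    and S: "S \<in> sets borel" "bounded S"
  shows "(\<integral>w. indicator S w * (\<integral>u. indicator S u * K (u - w) \<partial>lborel) \<partial>lborel) \<ge> 0"
proof -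
  have [measurable]: "K \<in> borel_measurable borel" using cont by (rule borel_measurable_continuous_onI)
  have [measurable]: "S \<in> sets borel" by fact
  obtain s :: "nat \<Rightarrow> 'a \<Rightarrow> 'a" where s: "\<And>i. simple_function lborel (s i)"
    and s_lim: "\<And>x. (\<lambda>i. s i x) \<longlonglongrightarrow> x" and s_bound: "\<And>i x. dist (s i x) 0 \<le> 2 * dist x 0"
    using borel_measurable_implies_sequence_metric[of "\<lambda>x::'a. x" lborel 0] by auto
  have [measurable]: "s i \<in> borel \<rightarrow>\<^sub>M borel" for i
    using borel_measurable_simple_function[OF s[of i]] by simp
  obtain \<rho> where \<rho>: "\<And>x. x \<in> S \<Longrightarrow> norm x \<le> \<rho>"
    using S(2) by (auto simp: bounded_iff)
  have "compact (K ` cball 0 (4 * \<rho>))"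
    by (intro compact_continuous_image continuous_on_subset[OF cont]) auto
  then obtain B where B: "\<And>p. norm p \<le> 4 * \<rho> \<Longrightarrow> norm (K p) \<le> B"
    using compact_imp_bounded by (force simp: bounded_iff)
  have B': "norm (indicator S u * (indicator S w * K (s i u - s i w))) \<le> B * (indicator S u * indicator S w)" for i u w
  proof (cases "u \<in> S \<and> w \<in> S")
    case True
    have "norm (s i u - s i w) \<le> norm (s i u) + norm (s i w)" by (rule norm_triangle_ineq4)
    also have "\<dots> \<le> 4 * \<rho>"
      using s_bound[of i u] s_bound[of i w] \<rho>[of u] \<rho>[of w] True by simp
    finally show ?thesis using B True by simp
  qed auto
  have Sint: "integrable lborel (indicator S :: 'a \<Rightarrow> real)"
    using S emeasure_bounded_finite by (intro integrable_real_indicator) auto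
  \<comment> \<open>the double integral with \<open>u\<close> and \<open>w\<close> replaced by their simple approximations; it is one of
    the sums in the definition of positive definiteness\<close>
  define J where "J i w = indicator S w * (\<integral>u. indicator S u * K (s i u - s i w) \<partial>lborel)" for i w
  have J_nonneg: "integral\<^sup>L lborel (J i) \<ge> 0" for i
  proof -
    let ?V = "range (s i)" and ?\<mu> = "\<lambda>a. measure lborel (s i -` {a} \<inter> S)"
    have "J i w = indicator S w * (\<Sum>a\<in>?V. ?\<mu> a * K (a - s i w))" for w
      unfolding J_def
      by (simp only: integral_indicator_comp_simple_function[OF s[of i] S, of "\<lambda>a. K (a - s i w)"])
    hence "J i = (\<lambda>w. indicator S w * (\<Sum>a\<in>?V. ?\<mu> a * K (a - s i w)))" by (rule ext)
    hence "integral\<^sup>L lborel (J i) = (\<Sum>b\<in>?V. ?\<mu> b * (\<Sum>a\<in>?V. ?\<mu> a * K (a - b)))"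
      by (simp only: integral_indicator_comp_simple_function[OF s[of i] S, of "\<lambda>b. \<Sum>a\<in>?V. ?\<mu> a * K (a - b)"])
    also have "\<dots> = (\<Sum>a\<in>?V. \<Sum>b\<in>?V. ?\<mu> a * K (a - b) * ?\<mu> b)"
      unfolding sum_distrib_left by (subst sum.swap) (simp add: mult_ac)
    also have "\<dots> \<ge> 0" using simple_functionD(1)[OF s[of i]] by (intro pd) simp
    finally show ?thesis .
  qed
  have J_lim: "(\<lambda>i. J i w) \<longlonglongrightarrow> indicator S w * (\<integral>u. indicator S u * K (u - w) \<partial>lborel)" for w
  proof -
    have "(\<lambda>i. \<integral>u. indicator S w * (indicator S u * K (s i u - s i w)) \<partial>lborel)
        \<longlonglongrightarrow> (\<integral>u. indicator S w * (indicator S u * K (u - w)) \<partial>lborel)"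
    proof (rule integral_dominated_convergence)
      show "integrable lborel (\<lambda>u. B * (indicator S u * indicator S w))"
        using Sint by simp
      show "AE u in lborel. (\<lambda>i. indicator S w * (indicator S u * K (s i u - s i w)))
          \<longlonglongrightarrow> indicator S w * (indicator S u * K (u - w))"
      proof (intro AE_I2 tendsto_intros)
        fix u show "(\<lambda>i. K (s i u - s i w)) \<longlonglongrightarrow> K (u - w)"
          by (rule continuous_on_tendsto_compose[OF cont]) (auto intro!: tendsto_intros s_lim)
      qed
      show "AE u in lborel. norm (indicator S w * (indicator S u * K (s i u - s i w)))
          \<le> B * (indicator S u * indicator S w)" for i
        using B' by (simp add: mult.left_commute)
    qed measurable
    thus ?thesis by (simp add: J_def)
  qed
  have "(\<lambda>i. integral\<^sup>L lborel (J i)) \<longlonglongrightarrow>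
      (\<integral>w. indicator S w * (\<integral>u. indicator S u * K (u - w) \<partial>lborel) \<partial>lborel)"
  proof (rule integral_dominated_convergence)
    show "integrable lborel (\<lambda>w. B * (measure lborel S * indicator S w))"
      using Sint by simp
    show "AE w in lborel. (\<lambda>i. J i w) \<longlonglongrightarrow> indicator S w * (\<integral>u. indicator S u * K (u - w) \<partial>lborel)"
      using J_lim by simp
    show "AE w in lborel. norm (J i w) \<le> B * (measure lborel S * indicator S w)" for i
    proof (intro AE_I2)
      fix w
      let ?f = "\<lambda>u. indicator S u * (indicator S w * K (s i u - s i w))"
      let ?g = "\<lambda>u. B * (indicator S u * indicator S w) :: real"
      have g: "integrable lborel ?g" using Sint by simp
      have f: "integrable lborel ?f"
      proof (rule Bochner_Integration.integrable_bound[OF g])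
        show "AE u in lborel. norm (?f u) \<le> norm (?g u)"
          using order_trans[OF B' abs_ge_self] unfolding real_norm_def by (intro AE_I2)
      qed measurable
      have "J i w = (\<integral>u. indicator S w * (indicator S u * K (s i u - s i w)) \<partial>lborel)"
        by (simp add: J_def)
      also have "\<dots> = integral\<^sup>L lborel ?f"
        by (rule Bochner_Integration.integral_cong) (simp_all add: mult.left_commute)
      also have "norm \<dots> \<le> integral\<^sup>L lborel ?g"
        by (rule Bochner_Integration.integral_norm_bound_integral[OF f g B'])
      finally show "norm (J i w) \<le> B * (measure lborel S * indicator S w)"
        by (simp add: mult_ac)
    qed
    show "J i \<in> borel_measurable lborel" for i unfolding J_def by measurable
  qed measurable
  thus ?thesis using J_nonneg by (intro LIMSEQ_le_const) auto
qed

text \<open>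
  Average \<open>K(u - w)\<close> over \<open>u\<close> and \<open>w\<close> in a large ball \<open>S\<close>. Substituting \<open>z = u - w\<close> gives the integral of
  \<open>K(z)\<close> against the fraction of \<open>S\<close> that stays in \<open>S\<close> after translation by \<open>z\<close>. This fraction tends
  to 1 as the radius grows.
\<close>

lemma positive_definite_integral_nonneg:
  fixes K :: "'a::euclidean_space \<Rightarrow> real"
  assumes cont: "continuous_on UNIV K"
    and pd: "\<And>V b. finite V \<Longrightarrow> (\<Sum>u\<in>V. \<Sum>w\<in>V. b u * K (u - w) * b w) \<ge> 0"
    and int: "integrable lborel K"
  shows "integral\<^sup>L lborel K \<ge> 0"
proof -
  have [measurable]: "K \<in> borel_measurable borel" using cont by (rule borel_measurable_continuous_onI)
  define S where "S n = ball (0::'a) (real (Suc n))" for n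
  have [measurable]: "S n \<in> sets borel" for n by (simp add: S_def)
  have Sint: "integrable lborel (indicator (S n) :: 'a \<Rightarrow> real)" for n
    using emeasure_bounded_finite[of "S n"] by (intro integrable_real_indicator) (auto simp: S_def)
  define A where "A n z = (\<integral>w. indicator (S n) w * indicator (S n) (w + z) \<partial>lborel) / measure lborel (S n)" for n z
  have Spos: "measure lborel (S n) > 0" for n unfolding S_def by (rule content_ball_pos) simp
  have Aint: "integrable lborel (\<lambda>w. indicator (S n) w * indicator (S n) (w + z) :: real)" for n z
    by (rule Bochner_Integration.integrable_bound[OF Sint[of n]]) (auto simp: indicator_def)
  have A_le: "A n z \<le> 1" for n z
  proof -
    have "(\<integral>w. indicator (S n) w * indicator (S n) (w + z) \<partial>lborel) \<le> (\<integral>w. indicator (S n) w \<partial>lborel :: real)"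
      by (intro integral_mono Aint Sint) (auto simp: indicator_def)
    thus ?thesis using Spos[of n] by (simp add: A_def)
  qed
  have A_nonneg: "A n z \<ge> 0" for n z
    using Spos[of n] unfolding A_def by (intro divide_nonneg_pos integral_nonneg_AE) auto
  have A_lim: "(\<lambda>n. A n z) \<longlonglongrightarrow> 1" for z
  proof (rule tendsto_sandwich)
    show "eventually (\<lambda>n. A n z \<le> 1) sequentially" using A_le by simp
    show "(\<lambda>n. (1 - norm z / real (Suc n)) ^ DIM('a)) \<longlonglongrightarrow> 1"
    proof -
      have "(\<lambda>n. norm z / real (Suc n)) \<longlonglongrightarrow> 0"
        by (rule LIMSEQ_Suc[OF lim_const_over_n])
      from tendsto_power[OF tendsto_diff[OF tendsto_const[of 1] this], of "DIM('a)"] show ?thesis by simp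
    qed
    show "eventually (\<lambda>n. (1 - norm z / real (Suc n)) ^ DIM('a) \<le> A n z) sequentially"
      using eventually_ge_at_top[of "nat \<lceil>norm z\<rceil>"]
    proof eventually_elim
      case (elim n)
      hence n: "norm z \<le> real (Suc n)" by linarith
      \<comment> \<open>points this close to the centre cannot leave the ball when translated by \<open>z\<close>\<close>
      let ?T = "ball (0::'a) (real (Suc n) - norm z)"
      have sub: "indicator ?T w \<le> (indicator (S n) w * indicator (S n) (w + z) :: real)" for w
      proof (cases "w \<in> ?T")
        case True
        hence "norm w < real (Suc n)" "norm (w + z) < real (Suc n)"
          using norm_triangle_ineq[of w z] norm_ge_zero[of z] by (simp_all del: norm_ge_zero)
        thus ?thesis by (simp add: S_def)
      qed auto
      have "measure lborel ?T = (\<integral>w. indicator ?T w \<partial>lborel)" by simp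
      also have "\<dots> \<le> (\<integral>w. indicator (S n) w * indicator (S n) (w + z) \<partial>lborel)"
        using sub Aint emeasure_bounded_finite[of ?T]
        by (intro integral_mono integrable_real_indicator) auto
      finally have le: "measure lborel ?T \<le> (\<integral>w. indicator (S n) w * indicator (S n) (w + z) \<partial>lborel)" .
      have ub: "unit_ball_vol (real DIM('a)) \<noteq> 0"
        by (rule less_imp_neq[symmetric], rule unit_ball_vol_pos) simp
      have "measure lborel ?T / measure lborel (S n) \<le> A n z"
        unfolding A_def using Spos[of n] by (intro divide_right_mono le) auto
      moreover have "measure lborel ?T / measure lborel (S n) = ((real (Suc n) - norm z) / real (Suc n)) ^ DIM('a)"
      proof -
        have "measure lborel ?T = unit_ball_vol DIM('a) * (real (Suc n) - norm z) ^ DIM('a)"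
          using n by (intro content_ball) linarith
        moreover have "measure lborel (S n) = unit_ball_vol DIM('a) * real (Suc n) ^ DIM('a)"
          unfolding S_def by (intro content_ball) linarith
        ultimately show ?thesis by (simp only: power_divide mult_divide_mult_cancel_left[OF ub])
      qed
      ultimately show ?case by (simp add: diff_divide_distrib del: of_nat_Suc)
    qed
  qed auto
  have "(\<lambda>n. \<integral>z. A n z * K z \<partial>lborel) \<longlonglongrightarrow> (\<integral>z. K z \<partial>lborel)"
  proof (rule integral_dominated_convergence)
    show "integrable lborel (\<lambda>z. norm (K z))" using int by simp
    show "AE z in lborel. (\<lambda>n. A n z * K z) \<longlonglongrightarrow> K z"
    proof (intro AE_I2)
      fix z show "(\<lambda>n. A n z * K z) \<longlonglongrightarrow> K z"
        using tendsto_mult[OF A_lim[of z] tendsto_const[of "K z"]] by simp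
    qed
    show "AE z in lborel. norm (A n z * K z) \<le> norm (K z)" for n
      using A_le A_nonneg by (intro AE_I2) (simp add: abs_mult mult_left_le_one_le)
    show "(\<lambda>z. A n z * K z) \<in> borel_measurable lborel" for n unfolding A_def by measurable
  qed (use int in auto)
  moreover have "(\<integral>z. A n z * K z \<partial>lborel) \<ge> 0" for n
  proof -
    have tr: "(\<integral>u. indicator (S n) u * K (u - w) \<partial>lborel) =
        (\<integral>z. indicator (S n) (w + z) * K z \<partial>lborel)" for w
    proof -
      have "(\<integral>u. indicator (S n) u * K (u - w) \<partial>distr lborel borel ((+) w)) =
          (\<integral>z. indicator (S n) (w + z) * K (w + z - w) \<partial>lborel)"
        by (rule integral_distr) measurable
      thus ?thesis by (simp add: lborel_distr_plus)
    qed
    have "0 \<le> (\<integral>w. indicator (S n) w * (\<integral>u. indicator (S n) u * K (u - w) \<partial>lborel) \<partial>lborel)"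
      by (rule positive_definite_double_integral_nonneg[OF cont pd]) (auto simp: S_def)
    also have "\<dots> = (\<integral>w. indicator (S n) w * (\<integral>z. indicator (S n) (w + z) * K z \<partial>lborel) \<partial>lborel)"
      by (simp only: tr)
    also have "\<dots> = (\<integral>w. (\<integral>z. indicator (S n) w * indicator (S n) (w + z) * K z \<partial>lborel) \<partial>lborel)"
      by (simp add: mult.assoc)
    also have "\<dots> = (\<integral>z. (\<integral>w. indicator (S n) w * indicator (S n) (w + z) * K z \<partial>lborel) \<partial>lborel)"
    proof (rule lborel_pair.Fubini_integral[symmetric])
      define f where "f w z = indicator (S n) w * indicator (S n) (w + z) * K z" for w z
      have "integrable (lborel \<Otimes>\<^sub>M lborel) (case_prod f)"
      proof (rule integrable_pair_bounded_by_product[OF sigma_finite_lborel sigma_finite_lborel _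
            Sint[of n] integrable_norm[OF int]])
        show "case_prod f \<in> borel_measurable (lborel \<Otimes>\<^sub>M lborel)"
          unfolding f_def[abs_def] by measurable
        show "\<bar>f w z\<bar> \<le> indicator (S n) w * norm (K z)" for w z
          by (auto simp: f_def indicator_def)
      qed
      thus "integrable (lborel \<Otimes>\<^sub>M lborel) (\<lambda>(w, z). indicator (S n) w * indicator (S n) (w + z) * K z)"
        by (simp add: f_def[abs_def])
    qed
    also have "\<dots> = measure lborel (S n) * (\<integral>z. A n z * K z \<partial>lborel)"
    proof -
      have "(\<integral>w. indicator (S n) w * indicator (S n) (w + z) * K z \<partial>lborel) =
          measure lborel (S n) * (A n z * K z)" for z
        using Spos[of n] by (simp add: A_def)
      thus ?thesis by (simp only: integral_mult_right_zero)
    qed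
    finally show ?thesis using Spos[of n] by (simp add: zero_le_mult_iff)
  qed
  ultimately show ?thesis by (intro LIMSEQ_le_const) auto
qed

section \<open>Integrating a positive definite kernel over planes\<close>

text \<open>
  Polar coordinates in the plane together with the substitution \<open>v = sqrt(t\<^sup>2 + \<rho>\<^sup>2)\<close>, as an identity of
  measures. For \<open>v > t\<close>, both sides give \<open>{..<v}\<close> the area of the disc of radius
  \<open>sqrt(v\<^sup>2 - t\<^sup>2)\<close>, and 0 otherwise.
\<close>

lemma distr_sqrt_norm_complex:
  assumes "t \<ge> 0"
  shows "distr lborel borel (\<lambda>z::complex. sqrt (t\<^sup>2 + (norm z)\<^sup>2)) =
    density lborel (\<lambda>v. ennreal (2 * pi * (indicator {t..} v * v)))"
    (is "?M = ?N")
proof (rule measure_eqI_generator_eq[where E = "range lessThan" and \<Omega> = UNIV and A = "\<lambda>i. {..<real i}"])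
  have M: "emeasure ?M {..<v} = ennreal (pi * (v\<^sup>2 - t\<^sup>2))" if "v > t" for v
  proof -
    have "(\<lambda>z::complex. sqrt (t\<^sup>2 + (norm z)\<^sup>2)) -` {..<v} = ball 0 (sqrt (v\<^sup>2 - t\<^sup>2))"
    proof (intro set_eqI)
      fix z :: complex
      have "sqrt (t\<^sup>2 + (norm z)\<^sup>2) < v \<longleftrightarrow> t\<^sup>2 + (norm z)\<^sup>2 < v\<^sup>2"
        using real_sqrt_less_iff[of "t\<^sup>2 + (norm z)\<^sup>2" "v\<^sup>2"] that assms by simp
      also have "\<dots> \<longleftrightarrow> (norm z)\<^sup>2 < v\<^sup>2 - t\<^sup>2" by auto
      also have "\<dots> \<longleftrightarrow> norm z < sqrt (v\<^sup>2 - t\<^sup>2)"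
        using real_sqrt_less_iff[of "(norm z)\<^sup>2" "v\<^sup>2 - t\<^sup>2"] by simp
      finally show "z \<in> (\<lambda>z::complex. sqrt (t\<^sup>2 + (norm z)\<^sup>2)) -` {..<v} \<longleftrightarrow> z \<in> ball 0 (sqrt (v\<^sup>2 - t\<^sup>2))"
        by simp
    qed
    moreover have "t\<^sup>2 \<le> v\<^sup>2" using that assms by (intro power_mono) auto
    ultimately show ?thesis
      by (subst emeasure_distr) (auto simp: emeasure_ball unit_ball_vol_2)
  qed
  have M0: "emeasure ?M {..<v} = 0" if "v \<le> t" for v
  proof -
    have "sqrt (t\<^sup>2 + (norm z)\<^sup>2) \<ge> t" for z :: complex
      by (rule real_le_rsqrt) simp
    hence "\<not> sqrt (t\<^sup>2 + (norm z)\<^sup>2) < v" for z :: complex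
      using that by (meson leD order_trans)
    hence "(\<lambda>z::complex. sqrt (t\<^sup>2 + (norm z)\<^sup>2)) -` {..<v} = {}" by auto
    thus ?thesis by (subst emeasure_distr) auto
  qed
  have N: "emeasure ?N {..<v} = (\<integral>\<^sup>+s. ennreal (2 * pi * s) * indicator {t..v} s \<partial>lborel)" for v
  proof -
    have "emeasure ?N {..<v} = (\<integral>\<^sup>+s. ennreal (2 * pi * (indicator {t..} s * s)) * indicator {..<v} s \<partial>lborel)"
      by (subst emeasure_density) auto
    also have "\<dots> = (\<integral>\<^sup>+s. ennreal (2 * pi * s) * indicator {t..v} s \<partial>lborel)"
      by (intro nn_integral_cong_AE) (use AE_lborel_singleton[of v] in \<open>auto simp: indicator_def\<close>)
    finally show ?thesis .
  qed
  have N1: "emeasure ?N {..<v} = ennreal (pi * (v\<^sup>2 - t\<^sup>2))" if "v > t" for v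
  proof -
    have "(\<integral>\<^sup>+s. ennreal (2 * pi * s) * indicator {t..v} s \<partial>lborel) = ennreal (pi * v\<^sup>2 - pi * t\<^sup>2)"
      using that assms by (intro nn_integral_FTC_Icc) (auto intro!: derivative_eq_intros)
    thus ?thesis unfolding N by (simp add: right_diff_distrib)
  qed
  have N0: "emeasure ?N {..<v} = 0" if "v \<le> t" for v
  proof -
    have "AE s in lborel. ennreal (2 * pi * s) * indicator {t..v} s = 0"
      by (rule AE_mp[OF AE_lborel_singleton[of v]], intro AE_I2)
         (use that in \<open>auto simp: indicator_def\<close>)
    thus ?thesis unfolding N by (subst nn_integral_0_iff_AE) auto
  qed
  show "emeasure ?M X = emeasure ?N X" if "X \<in> range lessThan" for X
  proof -
    from that obtain v where "X = {..<v}" by auto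
    thus ?thesis using M M0 N1 N0 by (cases "v \<le> t") auto
  qed
  show "emeasure ?M {..<real i} \<noteq> \<infinity>" for i
    using M M0 by (cases "real i \<le> t") auto
  show "Int_stable (range (lessThan :: real \<Rightarrow> _))"
    unfolding Int_stable_def
  proof (clarify)
    fix a b :: real
    have "{..<a} \<inter> {..<b} = {..<min a b}" by auto
    thus "{..<a} \<inter> {..<b} \<in> range lessThan" by blast
  qed
  show "(\<Union>i. {..<real i}) = UNIV"
    using reals_Archimedean2 by auto
  show "sets ?M = sigma_sets UNIV (range lessThan)" "sets ?N = sigma_sets UNIV (range lessThan)"
    by (simp_all only: sets_distr sets_density sets_lborel) (simp_all add: borel_Iio)
qed auto

lemma
  fixes h :: "real \<Rightarrow> real"
  assumes "t \<ge> 0" and [measurable]: "h \<in> borel_measurable borel"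
  shows integrable_radial_iff: "integrable lborel (\<lambda>z::complex. h (sqrt (t\<^sup>2 + (norm z)\<^sup>2))) \<longleftrightarrow>
      set_integrable lborel {t..} (\<lambda>v. v * h v)"
    and integral_radial: "(\<integral>z. h (sqrt (t\<^sup>2 + (norm (z::complex))\<^sup>2)) \<partial>lborel) =
      2 * pi * (LINT v:{t..}|lborel. v * h v)"
proof -
  let ?g = "\<lambda>z::complex. sqrt (t\<^sup>2 + (norm z)\<^sup>2)"
  have nn: "AE v in lborel. 0 \<le> 2 * pi * (indicator {t..} v * v)"
    using assms(1) by (auto simp: indicator_def)
  have "integrable lborel (\<lambda>z. h (?g z)) \<longleftrightarrow> integrable (distr lborel borel ?g) h"
    by (subst integrable_distr_eq) auto
  also have "\<dots> \<longleftrightarrow> integrable lborel (\<lambda>v. (2 * pi * (indicator {t..} v * v)) *\<^sub>R h v)"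
    unfolding distr_sqrt_norm_complex[OF assms(1)] using nn by (subst integrable_density) auto
  also have "(\<lambda>v. (2 * pi * (indicator {t..} v * v)) *\<^sub>R h v) =
      (\<lambda>v. (2 * pi) * (indicator {t..} v *\<^sub>R (v * h v)))" by (simp add: mult_ac)
  also have "integrable lborel \<dots> \<longleftrightarrow> set_integrable lborel {t..} (\<lambda>v. v * h v)"
    unfolding set_integrable_def by simp
  finally show "integrable lborel (\<lambda>z. h (?g z)) \<longleftrightarrow> set_integrable lborel {t..} (\<lambda>v. v * h v)" .
  have "(\<integral>z. h (?g z) \<partial>lborel) = integral\<^sup>L (distr lborel borel ?g) h"
    by (subst integral_distr) auto
  also have "\<dots> = (\<integral>v. (2 * pi * (indicator {t..} v * v)) *\<^sub>R h v \<partial>lborel)"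
    unfolding distr_sqrt_norm_complex[OF assms(1)] using nn by (subst integral_density) auto
  also have "\<dots> = (\<integral>v. (2 * pi) * (indicator {t..} v *\<^sub>R (v * h v)) \<partial>lborel)" by (simp add: mult_ac)
  also have "\<dots> = 2 * pi * (LINT v:{t..}|lborel. v * h v)"
    unfolding set_lebesgue_integral_def by (rule integral_mult_right_zero)
  finally show "(\<integral>z. h (?g z) \<partial>lborel) = 2 * pi * (LINT v:{t..}|lborel. v * h v)" .
qed

text \<open>
  The point of \<open>\<real>\<^sup>k\<^sup>+\<^sup>2\<close> whose first \<open>k\<close> coordinates are those of \<open>y\<close> and whose last two are the real and
  imaginary part of \<open>u\<close>. The value \<open>undefined\<close> beyond them makes it extensional.
\<close>

definition append_complex :: "nat \<Rightarrow> (nat \<Rightarrow> real) \<Rightarrow> complex \<Rightarrow> nat \<Rightarrow> real" where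
  "append_complex k y u l =
    (if l < k then y l else if l = k then Re u else if l = Suc k then Im u else undefined)"

lemma append_complex_in_euclid: "y \<in> euclid k \<Longrightarrow> append_complex k y u \<in> euclid (k + 2)"
  by (auto simp: euclid_def append_complex_def PiE_iff extensional_def)

lemma L2_set_append_complex:
  "L2_set (\<lambda>l. append_complex k y u l - append_complex k y' w l) {..<k + 2} =
    sqrt ((L2_set (\<lambda>l. y l - y' l) {..<k})\<^sup>2 + (norm (u - w))\<^sup>2)"
proof -
  have "(\<Sum>l<k. (append_complex k y u l - append_complex k y' w l)\<^sup>2) = (\<Sum>l<k. (y l - y' l)\<^sup>2)"
    by (intro sum.cong) (auto simp: append_complex_def)
  moreover have "(L2_set (\<lambda>l. y l - y' l) {..<k})\<^sup>2 = (\<Sum>l<k. (y l - y' l)\<^sup>2)"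
    by (simp add: L2_set_def sum_nonneg)
  ultimately show ?thesis
    unfolding L2_set_def cmod_def by (simp add: append_complex_def add.assoc numeral_2_eq_2)
qed

text \<open>
  Integrating the kernel over the difference of the last two coordinates leaves a positive definite
  kernel. The function \<open>K\<close> in the proof is the given quadratic form with those two differences
  collected in the complex variable. It is positive definite, because the original kernel is so at
  the points with arbitrary last two coordinates.
\<close>

lemma positive_definite_tail_integral:
  assumes \<phi>: "\<phi> \<in> pd_sphere_euclid d (k + 2)"
    and int: "\<And>x t. x \<in> {-1..1} \<Longrightarrow> t \<ge> 0 \<Longrightarrow> set_integrable lborel {t..} (\<lambda>v. v * \<phi> x v)"
  shows "positive_definite_on (unit_sphere d \<times> euclid k)
    (\<lambda>(x, y) (x', y'). LINT v:{L2_set (\<lambda>i. y i - y' i) {..<k}..}|lborel. v * \<phi> (cos (geodesic_dist d x x')) v)"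
  unfolding positive_definite_on_def
proof (intro allI impI)
  fix N :: nat and a :: "nat \<Rightarrow> real" and z :: "nat \<Rightarrow> (nat \<Rightarrow> real) \<times> (nat \<Rightarrow> real)"
  assume z: "\<forall>i<N. z i \<in> unit_sphere d \<times> euclid k"
  define X where "X i j = cos (geodesic_dist d (fst (z i)) (fst (z j)))" for i j
  define T where "T i j = L2_set (\<lambda>l. snd (z i) l - snd (z j) l) {..<k}" for i j
  \<comment> \<open>\<open>\<phi>\<close> is unconstrained for negative second argument; \<open>h\<close> is a continuous substitute\<close>
  define h where "h x v = \<phi> x (max 0 v)" for x v
  define K where "K \<zeta> = (\<Sum>i<N. \<Sum>j<N. a i * h (X i j) (sqrt ((T i j)\<^sup>2 + (norm \<zeta>)\<^sup>2)) * a j)" for \<zeta> :: complex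
  have X: "X i j \<in> {-1..1}" for i j by (simp add: X_def)
  have T: "T i j \<ge> 0" for i j by (simp add: T_def L2_set_nonneg)
  have cont: "continuous_on ({-1..1} \<times> {0..}) (\<lambda>(x, t). \<phi> x t)"
    and pd: "positive_definite_on (unit_sphere d \<times> euclid (k + 2))
           (\<lambda>(x, y) (x', y').
              \<phi> (cos (geodesic_dist d x x')) (L2_set (\<lambda>i. y i - y' i) {..<k + 2}))"
    using \<phi> by (auto simp: pd_sphere_euclid_def)
  have h_cont: "continuous_on UNIV (h x)" if "x \<in> {-1..1}" for x
  proof -
    have "continuous_on UNIV (\<lambda>v. (\<lambda>(x, t). \<phi> x t) (x, max 0 v))"
      by (rule continuous_on_compose2[OF cont]) (use that in \<open>auto intro!: continuous_intros\<close>)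
    thus ?thesis by (simp add: h_def[abs_def])
  qed
  have h_meas: "h x \<in> borel_measurable borel" if "x \<in> {-1..1}" for x
    using h_cont[OF that] by (rule borel_measurable_continuous_onI)
  have h_int: "set_integrable lborel {t..} (\<lambda>v. v * h x v)"
    and h_tail: "(LINT v:{t..}|lborel. v * h x v) = (LINT v:{t..}|lborel. v * \<phi> x v)"
    if "x \<in> {-1..1}" "t \<ge> 0" for x t
  proof -
    have eq: "v * h x v = v * \<phi> x v" if "v \<in> {t..}" for v
      using that \<open>t \<ge> 0\<close> by (simp add: h_def)
    show "set_integrable lborel {t..} (\<lambda>v. v * h x v)"
      using int[OF that] by (subst set_integrable_cong[OF refl refl eq]) auto
    show "(LINT v:{t..}|lborel. v * h x v) = (LINT v:{t..}|lborel. v * \<phi> x v)"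
      using eq by (intro set_lebesgue_integral_cong) auto
  qed
  have "integral\<^sup>L lborel K \<ge> 0"
  proof (rule positive_definite_integral_nonneg)
    show "continuous_on UNIV K"
      unfolding K_def
      by (intro continuous_on_sum continuous_on_mult continuous_on_const
            continuous_on_compose2[OF h_cont[OF X]] continuous_intros) auto
    show "integrable lborel K" unfolding K_def
      using integrable_radial_iff[OF T h_meas[OF X]] h_int[OF X T]
      by (intro Bochner_Integration.integrable_sum integrable_mult_left integrable_mult_right) auto
    fix V :: "complex set" and b assume V: "finite V"
    define P where "P p = (fst (z (fst p)), append_complex k (snd (z (fst p))) (snd p))" for p
    have "0 \<le> (\<Sum>p\<in>{..<N} \<times> V. \<Sum>q\<in>{..<N} \<times> V. (a (fst p) * b (snd p)) *
       (\<lambda>(x, y) (x', y').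
              \<phi> (cos (geodesic_dist d x x')) (L2_set (\<lambda>i. y i - y' i) {..<k + 2})) (P p) (P q) *
         (a (fst q) * b (snd q)))"
    proof (rule positive_definite_on_finite_sum[OF pd])
      show "P p \<in> unit_sphere d \<times> euclid (k + 2)" if "p \<in> {..<N} \<times> V" for p
      proof -
        have "z (fst p) \<in> unit_sphere d \<times> euclid k" using that z by auto
        thus ?thesis unfolding P_def
          using append_complex_in_euclid[of "snd (z (fst p))" k "snd p"] by (simp add: mem_Times_iff)
      qed
    qed (use V in auto)
    also have "\<dots> = (\<Sum>p\<in>{..<N} \<times> V. \<Sum>q\<in>{..<N} \<times> V.
        b (snd p) * (a (fst p) * h (X (fst p) (fst q)) (sqrt ((T (fst p) (fst q))\<^sup>2 + (norm (snd p - snd q))\<^sup>2)) * a (fst q)) * b (snd q))"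
    proof (intro sum.cong refl)
      fix p q
      have "L2_set (\<lambda>l. append_complex k (snd (z (fst p))) (snd p) l - append_complex k (snd (z (fst q))) (snd q) l) {..<k + 2} =
          sqrt ((T (fst p) (fst q))\<^sup>2 + (norm (snd p - snd q))\<^sup>2)"
        unfolding T_def by (rule L2_set_append_complex)
      thus "(a (fst p) * b (snd p)) *
       (\<lambda>(x, y) (x', y').
              \<phi> (cos (geodesic_dist d x x')) (L2_set (\<lambda>i. y i - y' i) {..<k + 2})) (P p) (P q) *
         (a (fst q) * b (snd q)) =
        b (snd p) * (a (fst p) * h (X (fst p) (fst q)) (sqrt ((T (fst p) (fst q))\<^sup>2 + (norm (snd p - snd q))\<^sup>2)) * a (fst q)) * b (snd q)"
        by (simp add: P_def X_def h_def mult_ac)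
    qed
    also have "\<dots> = (\<Sum>i<N. \<Sum>u\<in>V. \<Sum>j<N. \<Sum>w\<in>V. b u * (a i * h (X i j) (sqrt ((T i j)\<^sup>2 + (norm (u - w))\<^sup>2)) * a j) * b w)"
      by (simp add: sum.cartesian_product' split_def)
    also have "\<dots> = (\<Sum>u\<in>V. \<Sum>i<N. \<Sum>j<N. \<Sum>w\<in>V. b u * (a i * h (X i j) (sqrt ((T i j)\<^sup>2 + (norm (u - w))\<^sup>2)) * a j) * b w)"
      by (rule sum.swap)
    also have "\<dots> = (\<Sum>u\<in>V. \<Sum>w\<in>V. b u * K (u - w) * b w)"
    proof (intro sum.cong refl)
      fix u
      let ?G = "\<lambda>i j w. b u * (a i * h (X i j) (sqrt ((T i j)\<^sup>2 + (norm (u - w))\<^sup>2)) * a j) * b w"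
      have "(\<Sum>i<N. \<Sum>j<N. \<Sum>w\<in>V. ?G i j w) = (\<Sum>i<N. \<Sum>w\<in>V. \<Sum>j<N. ?G i j w)"
        by (intro sum.cong refl sum.swap)
      also have "\<dots> = (\<Sum>w\<in>V. \<Sum>i<N. \<Sum>j<N. ?G i j w)" by (rule sum.swap)
      finally show "(\<Sum>i<N. \<Sum>j<N. \<Sum>w\<in>V. ?G i j w) = (\<Sum>w\<in>V. b u * K (u - w) * b w)"
        unfolding K_def sum_distrib_left sum_distrib_right .
    qed
    finally show "0 \<le> (\<Sum>u\<in>V. \<Sum>w\<in>V. b u * K (u - w) * b w)" .
  qed
  also have "integral\<^sup>L lborel K = (\<Sum>i<N. \<Sum>j<N. a i * (2 * pi * (LINT v:{T i j..}|lborel. v * \<phi> (X i j) v)) * a j)"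
    unfolding K_def
    using integrable_radial_iff[OF T h_meas[OF X]] h_int[OF X T]
    by (subst Bochner_Integration.integral_sum; (intro Bochner_Integration.integrable_sum integrable_mult_left integrable_mult_right)?)
       (auto simp: Bochner_Integration.integral_sum integral_radial[OF T h_meas[OF X]] h_tail[OF X T])
  also have "\<dots> = 2 * pi * (\<Sum>i<N. \<Sum>j<N. a i * (LINT v:{T i j..}|lborel. v * \<phi> (X i j) v) * a j)"
    by (simp add: sum_distrib_left mult_ac)
  finally show "0 \<le> (\<Sum>i<N. \<Sum>j<N. a i *
      (case z i of (x, y) \<Rightarrow> \<lambda>(x', y'). LINT v:{L2_set (\<lambda>i. y i - y' i) {..<k}..}|lborel. v * \<phi> (cos (geodesic_dist d x x')) v) (z j) * a j)"
    by (simp add: zero_le_mult_iff X_def T_def split_def not_le[THEN iffD2, OF pi_gt_zero])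
qed

section \<open>The functions \<open>\<Omega>\<^sub>m\<close>\<close>

text \<open>
  Coefficients of the power series of \<open>\<Omega>\<^sub>m\<close> in \<open>t\<^sup>2\<close>. The index \<open>m\<close> is a real number.
\<close>

definition omega_coeff :: "real \<Rightarrow> nat \<Rightarrow> real" where
  "omega_coeff m j = (-1) ^ j / (4 ^ j * fact j * pochhammer (m / 2) j)"

text \<open>
  The entire function that, for positive integers \<open>m\<close>, coincides with \<open>\<Omega>\<^sub>m\<close> on \<open>[0,\<infinity>)\<close>,
  without the singular factors in the Bessel function representation.
\<close>

definition omega :: "real \<Rightarrow> real \<Rightarrow> real" where
  "omega m t = (\<Sum>j. omega_coeff m j * (t\<^sup>2) ^ j)"

lemma omega_coeff_0 [simp]: "omega_coeff m 0 = 1"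
  by (simp add: omega_coeff_def)

lemma omega_coeff_Suc:
  assumes "m > 0"
  shows "omega_coeff m (Suc j) = - omega_coeff m j / (2 * (1 + real j) * (m + 2 * real j))"
proof -
  define P D E where "P = pochhammer (m / 2) j" and "D = m + 2 * real j" and "E = 1 + real j"
  have pos: "P > 0" "D > 0" "E > 0"
    using assms by (auto simp: P_def D_def E_def intro!: pochhammer_pos)
  have 1: "pochhammer (m / 2) (Suc j) = P * (D / 2)"
    by (simp add: pochhammer_Suc P_def D_def add_divide_distrib)
  have 2: "fact (Suc j) = E * fact j" by (simp add: E_def)
  show ?thesis
    unfolding omega_coeff_def 1 2 P_def[symmetric] D_def[symmetric] E_def[symmetric]
    using pos by simp
qed

lemma summable_omega_coeff:
  assumes "m > 0"
  shows "summable (\<lambda>j. omega_coeff m j * s ^ j)"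
proof (rule summable_ratio_test[of "1/2" "nat \<lceil>\<bar>s\<bar>\<rceil>"])
  fix j assume "nat \<lceil>\<bar>s\<bar>\<rceil> \<le> j"
  hence j: "\<bar>s\<bar> \<le> real j" by linarith
  have 1: "\<bar>s\<bar> / (2 * (1 + real j) * (m + 2 * real j)) \<le> 1/2"
  proof -
    have "\<bar>s\<bar> * 1 \<le> (1 + real j) * (m + 2 * real j)"
    proof (cases "j = 0")
      case False
      thus ?thesis using assms j by (intro mult_mono) auto
    qed (use assms j in auto)
    moreover have "(1 + real j) * (m + 2 * real j) > 0"
      using assms by (intro mult_pos_pos) auto
    moreover define X where "X = (1 + real j) * (m + 2 * real j)"
    ultimately show ?thesis unfolding mult.assoc X_def[symmetric] by (simp add: field_simps)
  qed
  have "norm (omega_coeff m (Suc j) * s ^ Suc j) =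
      \<bar>s\<bar> / (2 * (1 + real j) * (m + 2 * real j)) * norm (omega_coeff m j * s ^ j)"
    using assms by (simp add: omega_coeff_Suc abs_mult power_abs)
  also have "\<dots> \<le> 1/2 * norm (omega_coeff m j * s ^ j)"
    by (intro mult_right_mono 1) auto
  finally show "norm (omega_coeff m (Suc j) * s ^ Suc j) \<le> 1/2 * norm (omega_coeff m j * s ^ j)" .
qed auto

lemma omega_0 [simp]: "omega m 0 = 1"
  by (simp add: omega_def)

lemma omega_coeff_shift:
  assumes "m > 0"
  shows "omega_coeff (m + 2) j = - (2 * m) * ((real j + 1) * omega_coeff m (Suc j))"
proof -
  have 1: "pochhammer (m / 2) (Suc j) = (m / 2) * pochhammer ((m + 2) / 2) j"
    by (simp add: pochhammer_rec add_divide_distrib)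
  have 2: "fact (Suc j) = (real j + 1) * fact j" by (simp add: add.commute)
  have "pochhammer ((m + 2) / 2) j > 0" "real j + 1 > 0"
    using assms by (auto intro!: pochhammer_pos)
  thus ?thesis
    unfolding omega_coeff_def 1 2 using assms by simp
qed

lemma DERIV_omega [derivative_intros]:
  assumes "m > 0" "(g has_real_derivative g') (at t within S)"
  shows "((\<lambda>t. omega m (g t)) has_real_derivative - (g t / m) * omega (m + 2) (g t) * g') (at t within S)"
proof -
  have *: "(omega m has_real_derivative - (t / m) * omega (m + 2) t) (at t)" for t
  proof -
    let ?h = "\<lambda>s. \<Sum>j. omega_coeff m j * s ^ j"
    have "(?h has_real_derivative (\<Sum>j. diffs (omega_coeff m) j * (t\<^sup>2) ^ j)) (at (t\<^sup>2))"
      by (rule termdiffs_strong_converges_everywhere) (rule summable_omega_coeff[OF assms(1)])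
    also have "diffs (omega_coeff m) = (\<lambda>j. - (1 / (2 * m)) * omega_coeff (m + 2) j)"
      using assms(1) by (auto simp: diffs_def omega_coeff_shift fun_eq_iff field_simps)
    also have "(\<Sum>j. - (1 / (2 * m)) * omega_coeff (m + 2) j * (t\<^sup>2) ^ j)
        = - (1 / (2 * m)) * omega (m + 2) t"
      unfolding omega_def mult.assoc using assms(1)
      by (intro suminf_mult summable_omega_coeff) auto
    finally have h: "(?h has_real_derivative - (1 / (2 * m)) * omega (m + 2) t) (at (t\<^sup>2))" .
    have "((\<lambda>t. ?h (t\<^sup>2)) has_real_derivative - (1 / (2 * m)) * omega (m + 2) t * (2 * t)) (at t)"
      by (rule DERIV_chain2[where f = ?h and g = "\<lambda>t. t\<^sup>2", OF h]) (auto intro!: derivative_eq_intros)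
    thus ?thesis by (simp add: omega_def[abs_def] mult_ac)
  qed
  show ?thesis using DERIV_chain2[OF * assms(2)] by simp
qed

lemma continuous_on_omega [continuous_intros]:
  assumes "m > 0" "continuous_on S g"
  shows "continuous_on S (\<lambda>x. omega m (g x))"
proof -
  have "continuous_on UNIV (omega m)"
    by (intro continuous_at_imp_continuous_on ballI DERIV_isCont[OF DERIV_omega[OF assms(1) DERIV_ident]])
  from continuous_on_compose2[OF this assms(2)] show ?thesis by auto
qed

text \<open>
  Together with \<open>\<Omega>\<^sub>m' = -(t/m) \<Omega>\<^sub>m\<^sub>+\<^sub>2\<close> this is the differential equation
  \<open>y'' + ((m-1)/t) y' + y = 0\<close> of \<open>\<Omega>\<^sub>m\<close> in a form without division by \<open>t\<close>.
\<close>

lemma omega_contiguous: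
  assumes "m > 0"
  shows "omega m t = omega (m + 2) t - t\<^sup>2 / (m * (m + 2)) * omega (m + 4) t"
proof -
  have c: "omega_coeff m (Suc j) =
      omega_coeff (m + 2) (Suc j) - 1 / (m * (m + 2)) * omega_coeff (m + 4) j" for j
  proof -
    have 4: "omega_coeff (m + 4) j = - (2 * (m + 2)) * ((real j + 1) * omega_coeff (m + 2) (Suc j))"
      using omega_coeff_shift[of "m + 2" j] assms by (simp add: add.commute)
    have 2: "omega_coeff (m + 2) (Suc j) = - (2 * m) * ((real j + 2) * omega_coeff m (Suc (Suc j)))"
      using omega_coeff_shift[OF assms, of "Suc j"] by simp
    define D where "D = 2 * (2 + real j) * (m + 2 * real j + 2)"
    have "D > 0" using assms by (simp add: D_def)
    moreover have "omega_coeff m (Suc (Suc j)) = - omega_coeff m (Suc j) / D"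
      using omega_coeff_Suc[OF assms, of "Suc j"] by (simp add: D_def algebra_simps)
    ultimately have 3: "omega_coeff m (Suc j) =
        - (2 * (2 + real j) * (m + 2 * real j + 2)) * omega_coeff m (Suc (Suc j))"
      unfolding D_def[symmetric] by simp
    show ?thesis unfolding 4 2 3 using assms
      by (simp add: divide_simps) (simp add: algebra_simps)
  qed
  have S: "summable (\<lambda>j. omega_coeff (m + 2) (Suc j) * (t\<^sup>2) ^ Suc j)"
    using summable_omega_coeff[of "m + 2" "t\<^sup>2"] assms by (subst summable_Suc_iff) auto
  have S4: "summable (\<lambda>j. omega_coeff (m + 4) j * (t\<^sup>2) ^ j)"
    using assms by (intro summable_omega_coeff) auto
  have "omega m t = 1 + (\<Sum>j. omega_coeff m (Suc j) * (t\<^sup>2) ^ Suc j)"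
    unfolding omega_def using suminf_split_head[OF summable_omega_coeff[OF assms, of "t\<^sup>2"]] by simp
  also have "(\<Sum>j. omega_coeff m (Suc j) * (t\<^sup>2) ^ Suc j) =
      (\<Sum>j. omega_coeff (m + 2) (Suc j) * (t\<^sup>2) ^ Suc j -
            t\<^sup>2 / (m * (m + 2)) * (omega_coeff (m + 4) j * (t\<^sup>2) ^ j))"
    by (simp add: c algebra_simps)
  also have "\<dots> = (\<Sum>j. omega_coeff (m + 2) (Suc j) * (t\<^sup>2) ^ Suc j) -
      t\<^sup>2 / (m * (m + 2)) * omega (m + 4) t"
    unfolding omega_def suminf_mult[OF S4, symmetric]
    by (intro suminf_diff[symmetric] S summable_mult S4)
  also have "1 + \<dots> = omega (m + 2) t - t\<^sup>2 / (m * (m + 2)) * omega (m + 4) t"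
    unfolding omega_def using suminf_split_head[OF summable_omega_coeff[of "m + 2" "t\<^sup>2"]] assms by simp
  finally show ?thesis .
qed

text \<open>
  The energy \<open>\<Omega>\<^sub>m\<^sup>2 + (\<Omega>\<^sub>m')\<^sup>2\<close> equals 1 at 0, and it is nonincreasing on \<open>[0,\<infinity>)\<close> by the damping term of
  the differential equation, whose sign needs \<open>m \<ge> 1\<close>.
\<close>

lemma omega_energy_le:
  assumes "m \<ge> 1"
  shows "(omega m t)\<^sup>2 + (t / m * omega (m + 2) t)\<^sup>2 \<le> 1"
proof -
  define E where "E t = (omega m t)\<^sup>2 + (t / m * omega (m + 2) t)\<^sup>2" for t
  have m: "m > 0" using assms by simp
  have "E \<bar>t\<bar> \<le> E 0"
  proof (rule DERIV_nonpos_imp_nonincreasing[of 0 "\<bar>t\<bar>" E])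
    fix s :: real assume s: "0 \<le> s" "s \<le> \<bar>t\<bar>"
    have "(E has_real_derivative
        2 * omega m s * (- (s / m) * omega (m + 2) s) + 2 * (s / m * omega (m + 2) s) *
          (1 / m * omega (m + 2) s + s / m * (- (s / (m + 2)) * omega (m + 4) s))) (at s)"
      unfolding E_def using m
      by (auto intro!: derivative_eq_intros simp: add.commute)
         (simp add: divide_simps; simp add: algebra_simps)
    also have "2 * omega m s * (- (s / m) * omega (m + 2) s) + 2 * (s / m * omega (m + 2) s) *
          (1 / m * omega (m + 2) s + s / m * (- (s / (m + 2)) * omega (m + 4) s)) =
        - (2 * s * (m - 1) / m\<^sup>2 * (omega (m + 2) s)\<^sup>2)"
    proof -
      define A B where "A = omega (m + 2) s" and "B = s / (m + 2) * omega (m + 4) s"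
      have 1: "omega m s = A - s / m * B"
        using omega_contiguous[OF m, of s] m by (simp add: A_def B_def power2_eq_square)
      have 2: "s / m * (- (s / (m + 2)) * omega (m + 4) s) = - (s / m * B)"
        by (simp add: B_def)
      show ?thesis unfolding 1 2 A_def[symmetric] using m
        by (simp add: field_simps power2_eq_square)
    qed
    finally have "(E has_real_derivative - (2 * s * (m - 1) / m\<^sup>2 * (omega (m + 2) s)\<^sup>2)) (at s)" .
    moreover have "- (2 * s * (m - 1) / m\<^sup>2 * (omega (m + 2) s)\<^sup>2) \<le> 0"
      using assms s by simp
    ultimately show "\<exists>y. (E has_real_derivative y) (at s) \<and> y \<le> 0" by blast
  qed auto
  moreover have "omega a \<bar>t\<bar> = omega a t" for a by (simp add: omega_def)
  ultimately show ?thesis by (simp add: E_def power_mult_distrib power_divide)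
qed

lemma abs_omega_le_1:
  assumes "m \<ge> 1"
  shows "\<bar>omega m t\<bar> \<le> 1"
proof -
  have "(omega m t)\<^sup>2 \<le> 1"
    using omega_energy_le[OF assms, of t] zero_le_power2[of "t / m * omega (m + 2) t"] by linarith
  thus ?thesis by (simp add: abs_square_le_1)
qed

lemma abs_omega_decay:
  assumes "m \<ge> 1" "t > 0"
  shows "\<bar>omega (m + 2) t\<bar> \<le> m / t"
proof -
  have "(t / m * omega (m + 2) t)\<^sup>2 \<le> 1"
    using omega_energy_le[OF assms(1), of t] zero_le_power2[of "omega m t"] by linarith
  hence "\<bar>t / m * omega (m + 2) t\<bar> \<le> 1" by (simp only: abs_square_le_1)
  thus ?thesis using assms by (simp add: abs_mult field_simps)
qed

lemma Omega_eq_omega: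
  assumes "k \<ge> 1" "t \<ge> 0"
  shows "Omega k t = omega (real k) t"
proof (cases "t = 0")
  case False
  hence t: "t > 0" using assms by simp
  define a where "a = real k / 2"
  have a: "a > 0" using assms by (simp add: a_def)
  have term_eq: "(-1) ^ j / fact j * rGamma (real j + (real k - 2) / 2 + 1) *
      (t / 2) powr (2 * real j + (real k - 2) / 2)
    = (t / 2) powr (a - 1) / Gamma a * (omega_coeff (real k) j * (t\<^sup>2) ^ j)" for j
  proof -
    have "(t / 2) powr (2 * real j + (real k - 2) / 2) = (t / 2) powr (a - 1) * (t / 2) powr (real (2 * j))"
      unfolding powr_add[symmetric] by (simp add: a_def field_simps)
    also have "(t / 2) powr (real (2 * j)) = (t\<^sup>2) ^ j / 4 ^ j"
      using t by (subst powr_realpow) (auto simp: power_mult power_divide)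
    finally have 1: "(t / 2) powr (2 * real j + (real k - 2) / 2) =
      (t / 2) powr (a - 1) * ((t\<^sup>2) ^ j / 4 ^ j)" .
    have "pochhammer a j = Gamma (a + real j) / Gamma a"
      using a by (intro pochhammer_Gamma) (auto elim!: nonpos_Ints_cases)
    moreover have "Gamma a > 0" "Gamma (a + real j) > 0"
      using a by (auto intro!: Gamma_real_pos)
    ultimately have 2: "rGamma (real j + (real k - 2) / 2 + 1) = 1 / (Gamma a * pochhammer a j)"
      by (simp add: rGamma_inverse_Gamma a_def field_simps)
    show ?thesis unfolding 1 2 by (simp add: omega_coeff_def a_def mult_ac)
  qed
  have "bessel_J ((real k - 2) / 2) t = (t / 2) powr (a - 1) / Gamma a * omega (real k) t"
    unfolding bessel_J_def term_eq omega_def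
    using assms by (intro suminf_mult summable_omega_coeff) auto
  moreover have "(2 / t) powr (a - 1) * (t / 2) powr (a - 1) = 1"
    using t by (simp flip: powr_mult)
  moreover have "Gamma a > 0" using a by (rule Gamma_real_pos)
  moreover have "(real k - 2) / 2 = a - 1" by (simp add: a_def field_simps)
  ultimately show ?thesis using t
    by (simp only: Omega_def a_def[symmetric]) (simp add: mult_ac)
qed (simp add: Omega_def)

lemma integral_linear_weight_omega:
  assumes "m > 0" "r \<noteq> 0" "a \<le> b"
  shows "(LINT v:{a..b}|lborel. v * omega (m + 2) (v * r)) = m / r\<^sup>2 * (omega m (a * r) - omega m (b * r))"
proof -
  have "(LINT v:{a..b}|lborel. v * omega (m + 2) (v * r)) =
      - (m / r\<^sup>2) * omega m (b * r) - - (m / r\<^sup>2) * omega m (a * r)"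
    unfolding set_lebesgue_integral_def
  proof (rule integral_FTC_atLeastAtMost[OF assms(3)])
    show "continuous_on {a..b} (\<lambda>v. v * omega (m + 2) (v * r))"
      using assms by (intro continuous_intros) auto
    fix v
    have "((\<lambda>v. - (m / r\<^sup>2) * omega m (v * r)) has_real_derivative v * omega (m + 2) (v * r))
        (at v within {a..b})"
      using assms by (auto intro!: derivative_eq_intros simp: power2_eq_square)
    thus "((\<lambda>v. - (m / r\<^sup>2) * omega m (v * r)) has_vector_derivative v * omega (m + 2) (v * r))
        (at v within {a..b})"
      by (simp add: has_real_derivative_iff_has_vector_derivative)
  qed
  thus ?thesis by (simp add: algebra_simps)
qed

text \<open>
  The weighted mean of \<open>\<Omega>\<^sub>m\<close> is \<open>\<Omega>\<^sub>m\<^sub>+\<^sub>2\<close>, which decays at infinity even when \<open>\<Omega>\<^sub>m\<close> does not.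
\<close>

lemma integral_power_weight_omega:
  assumes "m \<ge> 1" "T \<ge> 0"
  shows "(LINT v:{0..T}|lborel. (real m * v ^ (m - 1)) * omega (real m) (v * r)) =
    T ^ m * omega (real m + 2) (T * r)"
proof -
  have "(LINT v:{0..T}|lborel. (real m * v ^ (m - 1)) * omega (real m) (v * r)) =
      T ^ m * omega (real m + 2) (T * r) - 0 ^ m * omega (real m + 2) (0 * r)"
    unfolding set_lebesgue_integral_def
  proof (rule integral_FTC_atLeastAtMost[OF assms(2)])
    show "continuous_on {0..T} (\<lambda>v. (real m * v ^ (m - 1)) * omega (real m) (v * r))"
      using assms by (intro continuous_intros) auto
    fix v
    have "((\<lambda>v. v ^ m * omega (real m + 2) (v * r)) has_real_derivative
         v ^ m * (- (v * r / (real m + 2)) * omega (real m + 4) (v * r) * r) +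
         real m * v ^ (m - 1) * omega (real m + 2) (v * r)) (at v within {0..T})"
      using assms by (auto intro!: derivative_eq_intros simp: add.assoc)
    also have "v ^ m * (- (v * r / (real m + 2)) * omega (real m + 4) (v * r) * r) +
         real m * v ^ (m - 1) * omega (real m + 2) (v * r) =
        (real m * v ^ (m - 1)) * omega (real m) (v * r)"
    proof -
      obtain l where l: "m = Suc l" using assms by (cases m) auto
      have "real m * omega (real m) (v * r) =
          real m * omega (real m + 2) (v * r) - v * r * r * v / (real m + 2) * omega (real m + 4) (v * r)"
        using omega_contiguous[of "real m" "v * r"] assms(1)
        by (simp add: right_diff_distrib power2_eq_square mult_ac)
      hence "v ^ l * (real m * omega (real m) (v * r)) = v ^ l * (real m * omega (real m + 2) (v * r) -
          v * r * r * v / (real m + 2) * omega (real m + 4) (v * r))" by simp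
      thus ?thesis unfolding l by (simp add: algebra_simps)
    qed
    finally show "((\<lambda>v. v ^ m * omega (real m + 2) (v * r)) has_vector_derivative
        (real m * v ^ (m - 1)) * omega (real m) (v * r)) (at v within {0..T})"
      by (simp add: has_real_derivative_iff_has_vector_derivative)
  qed
  thus ?thesis using assms by simp
qed

section \<open>Gegenbauer polynomials\<close>

unbundle no vec_syntax and fps_syntax

lemma fps_deriv_binomial_compose:
  fixes w :: "'a::field_char_0 fps"
  assumes "w $ 0 = 0"
  shows "(1 + w) * fps_deriv (fps_binomial c oo w) =
    fps_const c * fps_deriv w * (fps_binomial c oo w)"
proof -
  have "(1 + fps_X) * fps_deriv (fps_binomial c) = fps_const c * fps_binomial c"
    by (simp add: fps_binomial_deriv)
  hence "((1 + fps_X) * fps_deriv (fps_binomial c)) oo w = (fps_const c * fps_binomial c) oo w"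
    by simp
  hence "(1 + w) * (fps_deriv (fps_binomial c) oo w) = fps_const c * (fps_binomial c oo w)"
    using assms by (simp add: fps_compose_mult_distrib fps_compose_add_distrib)
  moreover have "fps_deriv (fps_binomial c oo w) = (fps_deriv (fps_binomial c) oo w) * fps_deriv w"
    using assms by (rule fps_compose_deriv)
  ultimately show ?thesis by (simp only: mult.assoc[symmetric]) (simp only: mult_ac)
qed

lemma fps_deriv_quadratic:
  "fps_deriv (fps_const a * fps_X + fps_X ^ 2) = fps_const a + 2 * (fps_X :: 'a::comm_ring_1 fps)"
proof -
  have "fps_deriv (fps_X * fps_X :: 'a fps) = fps_X + fps_X"
    by (subst fps_deriv_mult) simp
  thus ?thesis by (simp add: power2_eq_square)
qed

text \<open>
  The differential equation determines the series from its constant term, so two solutions over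
  different fields can be compared coefficient by coefficient.
\<close>

lemma fps_quadratic_ODE_recurrence:
  fixes y :: "'a::field_char_0 fps"
  assumes "(1 + fps_const a * fps_X + fps_X ^ 2) * fps_deriv y =
      fps_const c * (fps_const a + 2 * fps_X) * y"
  shows "of_nat (Suc n) * y $ Suc n = a * (c - of_nat n) * y $ n +
    (if n = 0 then 0 else (2 * c - of_nat (n - 1)) * y $ (n - 1))"
proof -
  have "Y = C * (A * y') + (C * (X * y') + C * (X * y')) - A * (X * Y) - X * (X * Y)"
    if "(1 + A * X + X ^ 2) * Y = C * (A + 2 * X) * y'" for A C X Y y' :: "'a fps"
    using that by (simp add: algebra_simps power2_eq_square)
  note coeff = arg_cong[OF this[OF assms], of "\<lambda>f. f $ n",
      unfolded fps_add_nth fps_sub_nth fps_mult_left_const_nth fps_X_mult_nth fps_deriv_nth]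
  consider "n = 0" | "n = 1" | l where "n = Suc (Suc l)"
    by (metis One_nat_def not0_implies_Suc)
  thus ?thesis
  proof cases
    case 3
    have "of_nat (n + 1) * y $ (n + 1) = c * (a * y $ n) + (c * y $ (n - 1) + c * y $ (n - 1)) -
        a * (of_nat n * y $ n) - of_nat (n - 1) * y $ (n - 1)"
      using coeff 3 by simp
    thus ?thesis using 3 by (simp add: algebra_simps del: of_nat_Suc)
  qed (use coeff in \<open>simp_all add: algebra_simps\<close>)
qed

lemma gegenbauer_generating_ODE:
  fixes x c :: "'a::field_char_0"
  defines "y \<equiv> fps_binomial c oo (fps_const (- 2 * x) * fps_X + fps_X ^ 2)"
  shows "(1 + fps_const (- 2 * x) * fps_X + fps_X ^ 2) * fps_deriv y =
      fps_const c * (fps_const (- 2 * x) + 2 * fps_X) * y"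
  using fps_deriv_binomial_compose[of "fps_const (- 2 * x) * fps_X + fps_X ^ 2" c]
  unfolding y_def fps_deriv_quadratic by (simp add: add.assoc)

text \<open>
  The product of the binomial series in \<open>-zX\<close> and \<open>-z'X\<close> satisfies the equation of the generating
  function, as \<open>(1 - zX)(1 - z'X) = 1 - (z + z')X + X\<^sup>2\<close>.
\<close>

lemma gegenbauer_factorization_ODE:
  fixes z z' c :: "'a::field_char_0"
  assumes "z * z' = 1"
  defines "P \<equiv> (fps_binomial c oo (fps_const (- z) * fps_X)) * (fps_binomial c oo (fps_const (- z') * fps_X))"
  shows "(1 + fps_const (- (z + z')) * fps_X + fps_X ^ 2) * fps_deriv P =
      fps_const c * (fps_const (- (z + z')) + 2 * fps_X) * P"
proof -
  define u v where "u = fps_const (- z) * fps_X" and "v = fps_const (- z') * fps_X"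
  define U V where "U = fps_binomial c oo u" and "V = fps_binomial c oo v"
  have U: "(1 + u) * fps_deriv U = fps_const c * fps_deriv u * U"
    unfolding U_def by (rule fps_deriv_binomial_compose) (simp add: u_def)
  have V: "(1 + v) * fps_deriv V = fps_const c * fps_deriv v * V"
    unfolding V_def by (rule fps_deriv_binomial_compose) (simp add: v_def)
  have "u * v = fps_const ((- z) * (- z')) * fps_X ^ 2"
    unfolding u_def v_def fps_const_mult[symmetric] by (simp only: mult_ac power2_eq_square)
  hence uv: "u * v = fps_X ^ 2" using assms by simp
  have "u + v = fps_const (- (z + z')) * fps_X"
    unfolding u_def v_def by (simp only: distrib_right[symmetric] fps_const_add) simp
  moreover have "(1 + u) * (1 + v) = 1 + (u + v + u * v)" by (simp add: algebra_simps)
  ultimately have w: "(1 + u) * (1 + v) = 1 + (fps_const (- (z + z')) * fps_X + fps_X ^ 2)"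
    by (simp only: uv)
  have "(1 + u) * (1 + v) * fps_deriv (U * V) =
      (1 + v) * V * ((1 + u) * fps_deriv U) + (1 + u) * U * ((1 + v) * fps_deriv V)"
    by (simp add: algebra_simps)
  also have "\<dots> = fps_const c * fps_deriv ((1 + u) * (1 + v)) * (U * V)"
    unfolding U V by (simp add: algebra_simps)
  also have "fps_deriv ((1 + u) * (1 + v)) = fps_const (- (z + z')) + 2 * fps_X"
    unfolding w fps_deriv_add[of 1] fps_deriv_quadratic by simp
  finally show ?thesis
    unfolding P_def u_def[symmetric] v_def[symmetric] U_def[symmetric] V_def[symmetric]
    by (simp only: w add.assoc)
qed

text \<open>
  The coefficients \<open>(\<lambda>)\<^sub>i / i!\<close> on the right are nonnegative for \<open>\<lambda> > 0\<close>, and \<open>z\<close> has modulus 1 and is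
  1 for \<open>x = 1\<close>. Hence the absolute value is largest at \<open>x = 1\<close>.
\<close>

lemma gegenbauer_eq_sum:
  assumes "x \<in> {-1..1}" "lam \<noteq> 0"
  defines "z \<equiv> cis (arccos x)"
  shows "complex_of_real (gegenbauer lam n x) =
    (\<Sum>i=0..n. of_real (pochhammer lam i / fact i * (pochhammer lam (n - i) / fact (n - i))) *
       (z ^ i * cnj z ^ (n - i)))"
proof -
  define c where "c = complex_of_real (- lam)"
  define P where "P = (fps_binomial c oo (fps_const (- z) * fps_X)) * (fps_binomial c oo (fps_const (- cnj z) * fps_X))"
  define y where "y = fps_binomial (- lam) oo (fps_const (- 2 * x) * fps_X + fps_X ^ 2)"
  have zz: "z * cnj z = 1" "z + cnj z = 2 * of_real x"
    using assms(1) sin_cos_squared_add2[of "arccos x"] unfolding z_def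
    by (auto simp: complex_eq_iff power2_eq_square[symmetric] cos_arccos)
  note recP = fps_quadratic_ODE_recurrence[OF gegenbauer_factorization_ODE[OF zz(1), of c, folded P_def]]
  note recy = fps_quadratic_ODE_recurrence[OF gegenbauer_generating_ODE[of x "- lam", folded y_def]]
  have "complex_of_real (y $ n) = P $ n"
  proof (induction n rule: less_induct)
    case (less n)
    show ?case
    proof (cases n)
      case 0
      thus ?thesis by (simp add: y_def P_def fps_compose_nth_0)
    next
      case (Suc l)
      have IH: "P $ l = complex_of_real (y $ l)" "P $ (l - 1) = complex_of_real (y $ (l - 1))"
        using less.IH Suc by simp_all
      have "of_nat (Suc l) * complex_of_real (y $ Suc l) = complex_of_real (of_nat (Suc l) * y $ Suc l)"
        by (simp only: of_real_mult of_real_of_nat_eq)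
      also have "\<dots> = of_nat (Suc l) * P $ Suc l"
        unfolding recP[of l] recy[of l] IH zz(2) c_def by simp
      finally have "of_nat (Suc l) * complex_of_real (y $ Suc l) = of_nat (Suc l) * P $ Suc l" .
      thus ?thesis using Suc by (simp del: of_nat_Suc)
    qed
  qed
  also have "P $ n = (\<Sum>i=0..n. ((- z) ^ i * (c gchoose i)) * ((- cnj z) ^ (n - i) * (c gchoose (n - i))))"
    unfolding P_def fps_compose_linear fps_mult_nth by simp
  also have "\<dots> = (\<Sum>i=0..n. of_real (pochhammer lam i / fact i * (pochhammer lam (n - i) / fact (n - i))) *
       (z ^ i * cnj z ^ (n - i)))"
  proof (rule sum.cong)
    have *: "(- w) ^ i * (c gchoose i) = of_real (pochhammer lam i / fact i) * w ^ i" for w i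
    proof -
      have c: "- c = of_real lam" by (simp add: c_def)
      have "(- w) ^ i * (c gchoose i) = ((-1) ^ i * (-1) ^ i) * (pochhammer (- c) i / fact i * w ^ i)"
        unfolding power_minus[of w i] gbinomial_pochhammer by (simp only: mult_ac times_divide_eq_right)
      also have "(-1::complex) ^ i * (-1) ^ i = 1" by (simp flip: power_mult_distrib)
      finally show ?thesis unfolding c by (simp add: pochhammer_of_real)
    qed
    show "((- z) ^ i * (c gchoose i)) * ((- cnj z) ^ (n - i) * (c gchoose (n - i))) =
      of_real (pochhammer lam i / fact i * (pochhammer lam (n - i) / fact (n - i))) *
       (z ^ i * cnj z ^ (n - i))" for i
      unfolding * by (simp add: mult_ac)
  qed simp
  finally show ?thesis using assms(2) by (simp add: gegenbauer_def y_def)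
qed

lemma abs_gegenbauer_le:
  assumes "x \<in> {-1..1}" "lam \<ge> 0"
  shows "\<bar>gegenbauer lam n x\<bar> \<le> gegenbauer lam n 1"
proof (cases "lam = 0")
  case True
  have "2 * \<bar>cos (real n * arccos x)\<bar> / real n \<le> 2 / real n" if "n \<noteq> 0"
    by (intro divide_right_mono) auto
  thus ?thesis by (auto simp: gegenbauer_def True abs_mult)
next
  case False
  let ?a = "\<lambda>i. pochhammer lam i / fact i * (pochhammer lam (n - i) / fact (n - i))"
  have a: "?a i \<ge> 0" for i using assms(2) False by (intro mult_nonneg_nonneg divide_nonneg_nonneg pochhammer_nonneg) auto
  have "\<bar>gegenbauer lam n x\<bar> = norm (complex_of_real (gegenbauer lam n x))" by simp
  also have "\<dots> \<le> (\<Sum>i=0..n. ?a i)"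
    unfolding gegenbauer_eq_sum[OF assms(1) False]
    by (intro order_trans[OF norm_sum] sum_mono)
       (simp only: norm_mult norm_of_real norm_power complex_mod_cnj norm_cis power_one mult_1_right
          abs_of_nonneg[OF a] order_refl)
  also have "\<dots> = gegenbauer lam n 1"
  proof -
    have "complex_of_real (gegenbauer lam n 1) = of_real (\<Sum>i=0..n. ?a i)"
      by (subst gegenbauer_eq_sum) (auto simp: False)
    thus ?thesis by (simp only: of_real_eq_iff)
  qed
  finally show ?thesis .
qed

lemma continuous_on_gegenbauer: "continuous_on {-1..1} (gegenbauer lam n)"
proof (cases "lam = 0")
  case True
  show ?thesis unfolding gegenbauer_def[abs_def] True
    by (cases "n = 0") (auto intro!: continuous_intros)
next
  case False
  have *: "continuous_on {-1..1} (\<lambda>x::real. ((fps_const (- 2 * x) * fps_X + fps_X ^ 2) ^ i) $ n)" for i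
  proof (induction i arbitrary: n)
    case (Suc i)
    have "(fps_const (- 2 * x) * fps_X + fps_X ^ 2) $ j =
        - 2 * x * (if j = 1 then 1 else 0) + (if j = 2 then 1 else 0)" for x :: real and j
      by (simp only: fps_add_nth fps_mult_left_const_nth fps_X_power_nth fps_X_nth)
    hence "continuous_on {-1..1} (\<lambda>x::real. (fps_const (- 2 * x) * fps_X + fps_X ^ 2) $ j)" for j
      by (simp only:) (intro continuous_intros)
    thus ?case unfolding power_Suc fps_mult_nth
      using Suc by (intro continuous_intros)
  qed auto
  show ?thesis unfolding gegenbauer_def[abs_def] using False
    by (simp only: fps_compose_nth if_False) (intro continuous_on_sum continuous_on_mult_left *)
qed

unbundle vec_syntax and no fps_syntax

section \<open>Interchanging sums and integrals\<close>

lemma measurable_from_restrict_borel: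
  assumes "sets F = sets (restrict_space borel S)" "h \<in> borel_measurable borel"
  shows "h \<in> borel_measurable F"
  using measurable_restrict_space1[OF assms(2), of S] assms(1) by (simp cong: measurable_cong_sets)

lemma integral_swap_interval:
  fixes q w p :: "real \<Rightarrow> real"
  assumes fin: "finite_measure F" and sets: "sets F = sets (restrict_space borel {0..})"
    and q: "continuous_on UNIV q" "\<And>u. \<bar>q u\<bar> \<le> 1"
    and w: "continuous_on UNIV w"
    and p: "p \<in> borel_measurable borel" "integrable F p"
  shows "(LINT t:{a..b}|lborel. w t * (\<integral>r. q (t * r) * p r \<partial>F)) =
    (\<integral>r. (LINT t:{a..b}|lborel. w t * q (t * r)) * p r \<partial>F)"
proof -
  interpret F: finite_measure F by fact
  have pair: "pair_sigma_finite lborel F"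
    by (simp add: pair_sigma_finite_def F.sigma_finite_measure_axioms sigma_finite_lborel)
  have [measurable]: "q \<in> borel_measurable borel" "w \<in> borel_measurable borel" "p \<in> borel_measurable F"
    "(\<lambda>r. r) \<in> borel_measurable F"
    using q(1) w p(1) sets by (auto intro: borel_measurable_continuous_onI measurable_from_restrict_borel)
  define f where "f t r = indicator {a..b} t * w t * (q (t * r) * p r)" for t r
  have w_int: "integrable lborel (\<lambda>t. \<bar>indicator {a..b} t * w t\<bar>)"
    using borel_integrable_atLeastAtMost'[OF continuous_on_subset[OF w]]
    by (auto simp: set_integrable_def)
  have "integrable (lborel \<Otimes>\<^sub>M F) (case_prod f)"
  proof (rule integrable_pair_bounded_by_product[OF sigma_finite_lborel F.sigma_finite_measure_axioms _ w_int integrable_abs[OF p(2)]])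
    show "case_prod f \<in> borel_measurable (lborel \<Otimes>\<^sub>M F)" unfolding f_def[abs_def] by measurable
    show "\<bar>f t r\<bar> \<le> \<bar>indicator {a..b} t * w t\<bar> * \<bar>p r\<bar>" for t r
      unfolding f_def abs_mult[of "indicator {a..b} t * w t"] abs_mult[of "q (t * r)"]
      using mult_right_mono[OF q(2)[of "t * r"], of "\<bar>p r\<bar>"] by (intro mult_left_mono) auto
  qed
  from pair_sigma_finite.Fubini_integral[OF pair this]
  have "(\<integral>r. (\<integral>t. f t r \<partial>lborel) \<partial>F) = (\<integral>t. (\<integral>r. f t r \<partial>F) \<partial>lborel)" .
  moreover have "(\<integral>t. f t r \<partial>lborel) = (LINT t:{a..b}|lborel. w t * q (t * r)) * p r" for r
  proof -
    have "(\<integral>t. f t r \<partial>lborel) = (\<integral>t. (indicator {a..b} t * (w t * q (t * r))) * p r \<partial>lborel)"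
      by (rule Bochner_Integration.integral_cong) (simp_all add: f_def mult_ac)
    thus ?thesis by (simp add: set_lebesgue_integral_def)
  qed
  moreover have "(\<integral>t. (\<integral>r. f t r \<partial>F) \<partial>lborel) =
      (LINT t:{a..b}|lborel. w t * (\<integral>r. q (t * r) * p r \<partial>F))"
    by (simp add: set_lebesgue_integral_def f_def mult.assoc)
  ultimately show ?thesis by simp
qed

lemma abs_integral_weighted_le:
  fixes q p :: "real \<Rightarrow> real"
  assumes sets: "sets F = sets (restrict_space borel {0..})"
    and q: "continuous_on UNIV q" "\<And>u. \<bar>q u\<bar> \<le> 1"
    and p: "p \<in> borel_measurable borel" "integrable F p" "\<And>r. p r \<ge> 0"
  shows "integrable F (\<lambda>r. q (t * r) * p r)"
    and "\<bar>\<integral>r. q (t * r) * p r \<partial>F\<bar> \<le> integral\<^sup>L F p"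
proof -
  have [measurable]: "q \<in> borel_measurable borel" "p \<in> borel_measurable F"
    "(\<lambda>r. r) \<in> borel_measurable F"
    using q(1) p(1) sets by (auto intro: borel_measurable_continuous_onI measurable_from_restrict_borel)
  have le: "norm (q (t * r) * p r) \<le> p r" for r
    using mult_right_mono[OF q(2)[of "t * r"] p(3)[of r]] p(3)[of r] by (simp add: abs_mult)
  show int: "integrable F (\<lambda>r. q (t * r) * p r)"
    by (rule Bochner_Integration.integrable_bound[OF p(2)])
       (use le p(3) in \<open>auto simp: abs_of_nonneg\<close>)
  show "\<bar>\<integral>r. q (t * r) * p r \<partial>F\<bar> \<le> integral\<^sup>L F p"
    using Bochner_Integration.integral_norm_bound_integral[OF int p(2) le] by simp
qed

lemma continuous_on_suminf:
  fixes f :: "nat \<Rightarrow> 'a::topological_space \<Rightarrow> real"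
  assumes "\<And>n. continuous_on S (f n)" "\<And>n x. x \<in> S \<Longrightarrow> \<bar>f n x\<bar> \<le> B n" "summable B"
  shows "continuous_on S (\<lambda>x. \<Sum>n. f n x)"
proof -
  have "uniform_limit S (\<lambda>N x. \<Sum>n<N. f n x) (\<lambda>x. \<Sum>n. f n x) sequentially"
    using assms(2,3) by (intro Weierstrass_m_test) auto
  thus ?thesis
    by (rule uniform_limit_theorem[rotated]) (auto intro!: always_eventually continuous_on_sum assms(1))
qed

lemma continuous_on_integral_weighted:
  fixes q p :: "real \<Rightarrow> real"
  assumes sets: "sets F = sets (restrict_space borel {0..})"
    and q: "continuous_on UNIV q" "\<And>u. \<bar>q u\<bar> \<le> 1"
    and p: "p \<in> borel_measurable borel" "integrable F p" "\<And>r. p r \<ge> 0"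
  shows "continuous_on UNIV (\<lambda>t. \<integral>r. q (t * r) * p r \<partial>F)"
  unfolding continuous_on_sequentially
proof (intro allI ballI impI, elim conjE)
  fix X :: "nat \<Rightarrow> real" and t assume X: "X \<longlonglongrightarrow> t"
  have [measurable]: "q \<in> borel_measurable borel" "p \<in> borel_measurable F"
    "(\<lambda>r. r) \<in> borel_measurable F"
    using q(1) p(1) sets by (auto intro: borel_measurable_continuous_onI measurable_from_restrict_borel)
  have "(\<lambda>i. \<integral>r. q (X i * r) * p r \<partial>F) \<longlonglongrightarrow> (\<integral>r. q (t * r) * p r \<partial>F)"
  proof (rule integral_dominated_convergence[OF _ _ p(2)])
    show "AE r in F. (\<lambda>i. q (X i * r) * p r) \<longlonglongrightarrow> q (t * r) * p r"
    proof (intro AE_I2 tendsto_mult tendsto_const)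
      fix r show "(\<lambda>i. q (X i * r)) \<longlonglongrightarrow> q (t * r)"
        by (rule continuous_on_tendsto_compose[OF q(1)]) (auto intro!: tendsto_intros X)
    qed
    show "AE r in F. norm (q (X i * r) * p r) \<le> p r" for i
    proof (intro AE_I2)
      fix r show "norm (q (X i * r) * p r) \<le> p r"
        using mult_right_mono[OF q(2)[of "X i * r"] p(3)[of r]] p(3)[of r] by (simp add: abs_mult)
    qed
  qed measurable
  thus "((\<lambda>t. \<integral>r. q (t * r) * p r \<partial>F) \<circ> X) \<longlonglongrightarrow> (\<integral>r. q (t * r) * p r \<partial>F)"
    by (simp add: o_def)
qed

lemma integral_series_swap:
  fixes q w p :: "real \<Rightarrow> real" and c :: "nat \<Rightarrow> real"
  assumes fin: "\<And>n. finite_measure (F n)" and sets: "\<And>n. sets (F n) = sets (restrict_space borel {0..})"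
    and q: "continuous_on UNIV q" "\<And>u. \<bar>q u\<bar> \<le> 1"
    and w: "continuous_on UNIV w"
    and p: "p \<in> borel_measurable borel" "\<And>n. integrable (F n) p" "\<And>r. p r \<ge> 0"
    and c: "summable (\<lambda>n. \<bar>c n\<bar> * integral\<^sup>L (F n) p)"
  shows "(LINT t:{a..b}|lborel. w t * (\<Sum>n. c n * (\<integral>r. q (t * r) * p r \<partial>F n))) =
    (\<Sum>n. c n * (\<integral>r. (LINT t:{a..b}|lborel. w t * q (t * r)) * p r \<partial>F n))"
proof -
  define \<Phi> where "\<Phi> n t = (\<integral>r. q (t * r) * p r \<partial>F n)" for n t
  have \<Phi>_le: "\<bar>\<Phi> n t\<bar> \<le> integral\<^sup>L (F n) p" for n t
    unfolding \<Phi>_def by (rule abs_integral_weighted_le(2)[OF sets q p])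
  have "continuous_on UNIV (\<Phi> n)" for n
    unfolding \<Phi>_def by (rule continuous_on_integral_weighted[OF sets q p])
  hence [measurable]: "\<Phi> n \<in> borel_measurable borel" for n by (rule borel_measurable_continuous_onI)
  have [measurable]: "w \<in> borel_measurable borel" using w by (rule borel_measurable_continuous_onI)
  define f where "f n t = indicator {a..b} t * w t * (c n * \<Phi> n t)" for n t
  have w_int: "integrable lborel (\<lambda>t. \<bar>indicator {a..b} t * w t\<bar>)"
    using borel_integrable_atLeastAtMost'[OF continuous_on_subset[OF w]]
    by (auto simp: set_integrable_def)
  have f_le: "norm (f n t) \<le> \<bar>indicator {a..b} t * w t\<bar> * (\<bar>c n\<bar> * integral\<^sup>L (F n) p)" for n t
    unfolding f_def real_norm_def abs_mult[of "indicator {a..b} t * w t"] abs_mult[of "c n"]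
    by (intro mult_left_mono \<Phi>_le) auto
  have bd_int: "integrable lborel (\<lambda>t. \<bar>indicator {a..b} t * w t\<bar> * (\<bar>c n\<bar> * integral\<^sup>L (F n) p))" for n
    by (rule integrable_mult_left[OF w_int])
  have f_int: "integrable lborel (f n)" for n
  proof (rule Bochner_Integration.integrable_bound[OF bd_int[of n]])
    show "AE t in lborel. norm (f n t) \<le> norm (\<bar>indicator {a..b} t * w t\<bar> * (\<bar>c n\<bar> * integral\<^sup>L (F n) p))"
      using order_trans[OF f_le abs_ge_self] unfolding real_norm_def by (intro AE_I2)
  qed (simp add: f_def[abs_def])
  have sum_c\<Phi>: "summable (\<lambda>n. \<bar>c n * \<Phi> n t\<bar>)" for t
    by (rule summable_comparison_test'[OF c, of 0]) (simp add: abs_mult mult_left_mono[OF \<Phi>_le])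
  have "(\<integral>t. (\<Sum>n. f n t) \<partial>lborel) = (\<Sum>n. integral\<^sup>L lborel (f n))"
  proof (rule integral_suminf[OF f_int])
    show "AE t in lborel. summable (\<lambda>n. norm (f n t))"
    proof (intro AE_I2)
      fix t
      show "summable (\<lambda>n. norm (f n t))"
        using summable_mult[OF sum_c\<Phi>[of t], of "\<bar>indicator {a..b} t * w t\<bar>"]
        by (simp add: f_def abs_mult mult.assoc)
    qed
    have "norm (\<integral>t. norm (f n t) \<partial>lborel) \<le>
        (\<integral>t. \<bar>indicator {a..b} t * w t\<bar> \<partial>lborel) * (\<bar>c n\<bar> * integral\<^sup>L (F n) p)" for n
    proof -
      have "0 \<le> (\<integral>t. norm (f n t) \<partial>lborel)" by (intro integral_nonneg_AE) simp
      moreover have "(\<integral>t. norm (f n t) \<partial>lborel) \<le>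
          (\<integral>t. \<bar>indicator {a..b} t * w t\<bar> * (\<bar>c n\<bar> * integral\<^sup>L (F n) p) \<partial>lborel)"
        by (intro integral_mono integrable_norm f_int bd_int f_le)
      ultimately show ?thesis by simp
    qed
    thus "summable (\<lambda>n. \<integral>t. norm (f n t) \<partial>lborel)"
      by (intro summable_comparison_test'[OF summable_mult[OF c], of 0])
  qed
  moreover have "(\<Sum>n. f n t) = indicator {a..b} t *\<^sub>R (w t * (\<Sum>n. c n * \<Phi> n t))" for t
    unfolding f_def by (subst suminf_mult[OF summable_rabs_cancel[OF sum_c\<Phi>]]) simp
  moreover have "integral\<^sup>L lborel (f n) =
      c n * (\<integral>r. (LINT t:{a..b}|lborel. w t * q (t * r)) * p r \<partial>F n)" for n
  proof -
    have "integral\<^sup>L lborel (f n) = (\<integral>t. c n * (indicator {a..b} t *\<^sub>R (w t * \<Phi> n t)) \<partial>lborel)"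
      by (rule Bochner_Integration.integral_cong) (simp_all add: f_def mult_ac)
    also have "\<dots> = c n * (LINT t:{a..b}|lborel. w t * \<Phi> n t)"
      unfolding set_lebesgue_integral_def by (rule integral_mult_right_zero)
    finally show ?thesis
      unfolding \<Phi>_def integral_swap_interval[OF fin sets q w p(1,2)] .
  qed
  ultimately show ?thesis unfolding set_lebesgue_integral_def \<Phi>_def by simp
qed

section \<open>Series of mixtures of \<open>\<Omega>\<^sub>m\<close>\<close>

text \<open>
  The series \<open>\<Sum>\<^sub>n c\<^sub>n \<integral> \<Omega>\<^sub>m(tr) p(r) dF\<^sub>n(r)\<close>. With \<open>c\<^sub>n = C\<^sub>n(x)\<close>, \<open>p(r) = r\<^sup>-\<^sup>2\<^sup>\<nu>\<close> and
  \<open>m = k - 2\<nu>\<close> it is \<open>\<Sum>\<^sub>n g\<^sub>n\<^sup>\<nu>(t) C\<^sub>n(x)\<close>.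
\<close>

definition omega_series ::
    "(nat \<Rightarrow> real) \<Rightarrow> (nat \<Rightarrow> real measure) \<Rightarrow> (real \<Rightarrow> real) \<Rightarrow> real \<Rightarrow> real \<Rightarrow> real" where
  "omega_series c F p m t = (\<Sum>n. c n * (\<integral>r. omega m (t * r) * p r \<partial>F n))"

lemma
  assumes sets: "\<And>n. sets (F n) = sets (restrict_space borel {0..})" and m: "m \<ge> 1"
    and p: "p \<in> borel_measurable borel" "\<And>n. integrable (F n) p" "\<And>r. p r \<ge> 0"
    and c: "summable (\<lambda>n. \<bar>c n\<bar> * integral\<^sup>L (F n) p)"
  shows summable_omega_series: "summable (\<lambda>n. c n * (\<integral>r. omega m (t * r) * p r \<partial>F n))"
    and abs_omega_series_le: "\<bar>omega_series c F p m t\<bar> \<le> (\<Sum>n. \<bar>c n\<bar> * integral\<^sup>L (F n) p)"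
    and continuous_on_omega_series: "continuous_on UNIV (omega_series c F p m)"
proof -
  have m0: "m > 0" using m by simp
  have om: "continuous_on UNIV (omega m)" using m0 by (intro continuous_intros) auto
  have le: "\<bar>c n * (\<integral>r. omega m (t * r) * p r \<partial>F n)\<bar> \<le> \<bar>c n\<bar> * integral\<^sup>L (F n) p" for n t
    unfolding abs_mult
    by (intro mult_left_mono abs_integral_weighted_le(2)[OF sets om abs_omega_le_1[OF m] p]) auto
  have abs: "summable (\<lambda>n. \<bar>c n * (\<integral>r. omega m (t * r) * p r \<partial>F n)\<bar>)"
    using le by (intro summable_comparison_test'[OF c, of 0]) simp
  show "summable (\<lambda>n. c n * (\<integral>r. omega m (t * r) * p r \<partial>F n))"
    by (rule summable_rabs_cancel[OF abs])
  show "\<bar>omega_series c F p m t\<bar> \<le> (\<Sum>n. \<bar>c n\<bar> * integral\<^sup>L (F n) p)"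
    unfolding omega_series_def
    by (rule order_trans[OF summable_rabs[OF abs] suminf_le[OF le abs c]])
  show "continuous_on UNIV (omega_series c F p m)"
    unfolding omega_series_def[abs_def]
    by (rule continuous_on_suminf[OF _ le c])
       (intro continuous_on_mult_left continuous_on_integral_weighted[OF sets om abs_omega_le_1[OF m] p])
qed

lemma omega_series_shift_tendsto_0:
  assumes sets: "\<And>n. sets (F n) = sets (restrict_space borel {0..})" and m: "m \<ge> 1"
    and p: "p \<in> borel_measurable borel" "\<And>n. integrable (F n) p" "\<And>r. p r \<ge> 0"
    and c: "summable (\<lambda>n. \<bar>c n\<bar> * integral\<^sup>L (F n) p)"
    and nz: "\<And>n. AE r in F n. r \<noteq> 0"
  shows "(\<lambda>i. omega_series c F p (m + 2) (real i)) \<longlonglongrightarrow> 0"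
proof -
  have m2: "m + 2 \<ge> 1" "m + 2 > 0" using m by auto
  have om: "continuous_on UNIV (omega (m + 2))" using m2 by (intro continuous_intros) auto
  have int_lim: "(\<lambda>i. \<integral>r. omega (m + 2) (real i * r) * p r \<partial>F n) \<longlonglongrightarrow> (\<integral>r. 0 \<partial>F n)" for n
  proof (rule integral_dominated_convergence[OF _ _ p(2)[of n]])
    have space: "space (F n) = {0..}"
      using sets_eq_imp_space_eq[OF sets[of n]] by (simp add: space_restrict_space)
    show "AE r in F n. (\<lambda>i. omega (m + 2) (real i * r) * p r) \<longlonglongrightarrow> 0"
    proof (rule AE_mp[OF nz[of n]], intro AE_I2 impI)
      fix r assume "r \<in> space (F n)" "r \<noteq> 0"
      hence r: "r > 0" using space by auto
      have "(\<lambda>i. omega (m + 2) (real i * r)) \<longlonglongrightarrow> 0"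
      proof (rule tendsto_rabs_zero_cancel, rule tendsto_sandwich[where f = "\<lambda>_. 0"])
        show "eventually (\<lambda>i. \<bar>omega (m + 2) (real i * r)\<bar> \<le> m / r / real i) sequentially"
          using eventually_gt_at_top[of 0]
        proof eventually_elim
          case (elim i)
          thus ?case using abs_omega_decay[OF m, of "real i * r"] r by (simp add: mult_ac)
        qed
        show "(\<lambda>i. m / r / real i) \<longlonglongrightarrow> 0" by (rule lim_const_over_n)
      qed auto
      from tendsto_mult_left_zero[OF this] show "(\<lambda>i. omega (m + 2) (real i * r) * p r) \<longlonglongrightarrow> 0" .
    qed
    show "AE r in F n. norm (omega (m + 2) (real i * r) * p r) \<le> p r" for i
    proof (intro AE_I2)
      fix r show "norm (omega (m + 2) (real i * r) * p r) \<le> p r"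
        using mult_right_mono[OF abs_omega_le_1[OF m2(1), of "real i * r"] p(3)[of r]] p(3)[of r]
        by (simp add: abs_mult)
    qed
    show "(\<lambda>r. omega (m + 2) (real i * r) * p r) \<in> borel_measurable (F n)" for i
      using abs_integral_weighted_le(1)[OF sets om abs_omega_le_1[OF m2(1)] p] by auto
  qed simp
  have "(\<lambda>i. \<Sum>n. c n * (\<integral>r. omega (m + 2) (real i * r) * p r \<partial>F n)) \<longlonglongrightarrow> (\<Sum>n. 0)"
  proof (rule tannerys_theorem[THEN conjunct2, THEN conjunct2, OF _ _ c])
    show "(\<lambda>i. c n * (\<integral>r. omega (m + 2) (real i * r) * p r \<partial>F n)) \<longlonglongrightarrow> 0" for n
      using tendsto_mult_left[OF int_lim[of n], of "c n"] by simp
    have "norm (c n * (\<integral>r. omega (m + 2) (real i * r) * p r \<partial>F n)) \<le> \<bar>c n\<bar> * integral\<^sup>L (F n) p" for n i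
      unfolding real_norm_def abs_mult
      by (intro mult_left_mono abs_integral_weighted_le(2)[OF sets om abs_omega_le_1[OF m2(1)] p]) auto
    thus "eventually (\<lambda>(n, i). norm (c n * (\<integral>r. omega (m + 2) (real i * r) * p r \<partial>F n))
        \<le> \<bar>c n\<bar> * integral\<^sup>L (F n) p) (at_top \<times>\<^sub>F sequentially)"
      by (intro always_eventually) auto
  qed simp
  thus ?thesis by (simp add: omega_series_def)
qed

lemma omega_series_shift_eq_mean:
  assumes fin: "\<And>n. finite_measure (F n)" and sets: "\<And>n. sets (F n) = sets (restrict_space borel {0..})"
    and m: "m \<ge> 1"
    and p: "p \<in> borel_measurable borel" "\<And>n. integrable (F n) p" "\<And>r. p r \<ge> 0"
    and c: "summable (\<lambda>n. \<bar>c n\<bar> * integral\<^sup>L (F n) p)"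
  shows "(LINT s:{0..1}|lborel. (real m * s ^ (m - 1)) * omega_series c F p (real m) (T * s)) =
    omega_series c F p (real m + 2) T"
proof -
  have m': "real m \<ge> 1" "real m > 0" using m by auto
  have q: "continuous_on UNIV (\<lambda>u. omega (real m) (T * u))"
    using m' by (intro continuous_intros) auto
  have w: "continuous_on UNIV (\<lambda>s. real m * s ^ (m - 1))" by (intro continuous_intros)
  have mean: "(LINT s:{0..1}|lborel. (real m * s ^ (m - 1)) * omega (real m) (T * (s * r))) =
      omega (real m + 2) (T * r)" for r
    using integral_power_weight_omega[OF m, of 1 "T * r"] by (simp only: mult.left_commute[of T]) simp
  have "(LINT s:{0..1}|lborel. (real m * s ^ (m - 1)) * omega_series c F p (real m) (T * s)) =
      (LINT s:{0..1}|lborel. (real m * s ^ (m - 1)) *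
        (\<Sum>n. c n * (\<integral>r. omega (real m) (T * (s * r)) * p r \<partial>F n)))"
    by (simp only: omega_series_def mult.assoc)
  also have "\<dots> = (\<Sum>n. c n * (\<integral>r.
      (LINT s:{0..1}|lborel. (real m * s ^ (m - 1)) * omega (real m) (T * (s * r))) * p r \<partial>F n))"
    by (rule integral_series_swap[OF fin sets q abs_omega_le_1[OF m'(1)] w p c])
  finally show ?thesis unfolding mean omega_series_def .
qed

text \<open>
  If a series of mixtures of \<open>\<Omega>\<^sub>m\<close> converges at infinity, its limit is 0: its weighted means over
  \<open>[0,T]\<close> have the same limit, and they are the series of mixtures of \<open>\<Omega>\<^sub>m\<^sub>+\<^sub>2\<close>.
\<close>

lemma omega_series_limit_unique:
  assumes fin: "\<And>n. finite_measure (F n)" and sets: "\<And>n. sets (F n) = sets (restrict_space borel {0..})"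
    and m: "m \<ge> 1"
    and p: "p \<in> borel_measurable borel" "\<And>n. integrable (F n) p" "\<And>r. p r \<ge> 0"
    and c: "summable (\<lambda>n. \<bar>c n\<bar> * integral\<^sup>L (F n) p)"
    and nz: "\<And>n. AE r in F n. r \<noteq> 0"
    and L: "(omega_series c F p (real m) \<longlongrightarrow> L) at_top"
  shows "L = 0"
proof -
  let ?M = "omega_series c F p (real m)"
  have m': "real m \<ge> 1" using m by simp
  let ?B = "\<Sum>n. \<bar>c n\<bar> * integral\<^sup>L (F n) p"
  have [measurable]: "?M \<in> borel_measurable borel"
    by (rule borel_measurable_continuous_onI[OF continuous_on_omega_series[OF sets m' p c]])
  define w where "w s = real m * s ^ (m - 1)" for s
  have w_int: "integrable lborel (\<lambda>s. indicator {0..1} s * w s)"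
  proof -
    have "continuous_on {0..1} w" unfolding w_def by (intro continuous_intros)
    from borel_integrable_atLeastAtMost'[OF this] show ?thesis by (simp add: set_integrable_def)
  qed
  have "(\<lambda>i. \<integral>s. indicator {0..1} s * w s * ?M (real i * s) \<partial>lborel) \<longlonglongrightarrow>
      (\<integral>s. indicator {0..1} s * w s * L \<partial>lborel)"
  proof (rule integral_dominated_convergence)
    show "integrable lborel (\<lambda>s. \<bar>indicator {0..1} s * w s\<bar> * ?B)"
      using w_int by (intro integrable_mult_left integrable_abs)
    show "AE s in lborel. (\<lambda>i. indicator {0..1} s * w s * ?M (real i * s)) \<longlonglongrightarrow> indicator {0..1} s * w s * L"
    proof (rule AE_mp[OF AE_lborel_singleton[of 0]], intro AE_I2 impI)
      fix s :: real assume "s \<noteq> 0"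
      show "(\<lambda>i. indicator {0..1} s * w s * ?M (real i * s)) \<longlonglongrightarrow> indicator {0..1} s * w s * L"
      proof (cases "s \<in> {0..1}")
        case True
        hence "filterlim (\<lambda>i. real i * s) at_top sequentially"
          using \<open>s \<noteq> 0\<close> by (intro filterlim_at_top_mult_tendsto_pos[OF tendsto_const _ filterlim_real_sequentially]) auto
        from tendsto_mult_left[OF filterlim_compose[OF L this]] show ?thesis .
      qed simp
    qed
    show "AE s in lborel. norm (indicator {0..1} s * w s * ?M (real i * s)) \<le> \<bar>indicator {0..1} s * w s\<bar> * ?B" for i
    proof (intro AE_I2)
      fix s
      show "norm (indicator {0..1} s * w s * ?M (real i * s)) \<le> \<bar>indicator {0..1} s * w s\<bar> * ?B"
        unfolding real_norm_def abs_mult[of "indicator {0..1} s * w s"]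
        by (intro mult_left_mono abs_omega_series_le[OF sets m' p c]) auto
    qed
    show "(\<lambda>s. indicator {0..1} s * w s * ?M (real i * s)) \<in> borel_measurable lborel" for i
      unfolding w_def by measurable
    show "(\<lambda>s. indicator {0..1} s * w s * L) \<in> borel_measurable lborel"
      unfolding w_def by measurable
  qed
  moreover have "(\<integral>s. indicator {0..1} s * w s * ?M (real i * s) \<partial>lborel) = omega_series c F p (real m + 2) (real i)" for i
    using omega_series_shift_eq_mean[OF fin sets m p c, of "real i"]
    by (simp only: w_def set_lebesgue_integral_def real_scaleR_def mult.assoc)
  moreover have "(\<integral>s. indicator {0..1} s * w s * L \<partial>lborel) = L"
  proof -
    have "(\<integral>s. indicator {0..1} s * w s \<partial>lborel) = 1"
      using integral_power_weight_omega[OF m, of 1 0]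
      by (simp only: w_def set_lebesgue_integral_def real_scaleR_def mult_zero_right omega_0 mult_1_right
          power_one zero_le_one simp_thms)
    thus ?thesis by simp
  qed
  ultimately have "(\<lambda>i. omega_series c F p (real m + 2) (real i)) \<longlonglongrightarrow> L"
    by (simp only:)
  thus ?thesis
    using omega_series_shift_tendsto_0[OF sets m' p c nz] LIMSEQ_unique by blast
qed

lemma tail_integral_omega_series:
  assumes fin: "\<And>n. finite_measure (F n)" and sets: "\<And>n. sets (F n) = sets (restrict_space borel {0..})"
    and m: "m \<ge> 1"
    and p: "p \<in> borel_measurable borel" "\<And>n. integrable (F n) p" "\<And>r. p r \<ge> 0"
    and c: "summable (\<lambda>n. \<bar>c n\<bar> * integral\<^sup>L (F n) p)"
  defines "p' \<equiv> \<lambda>r. p r / r\<^sup>2"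
  assumes p': "\<And>n. integrable (F n) p'"
    and c': "summable (\<lambda>n. \<bar>c n\<bar> * integral\<^sup>L (F n) p')"
    and nz: "\<And>n. AE r in F n. r \<noteq> 0"
    and int: "set_integrable lborel {t..} (\<lambda>v. v * omega_series c F p (real m + 2) v)"
  shows "(LINT v:{t..}|lborel. v * omega_series c F p (real m + 2) v) = real m * omega_series c F p' (real m) t"
proof -
  let ?M = "omega_series c F p' (real m)"
  have m': "real m \<ge> 1" "real m > 0" "real m + 2 \<ge> 1" using m by auto
  have p'': "p' \<in> borel_measurable borel" "\<And>r. p' r \<ge> 0"
    using p(1,3) by (auto simp: p'_def)
  have om: "continuous_on UNIV (omega (real m))" "continuous_on UNIV (omega (real m + 2))"
    using m' by (auto intro!: continuous_intros)
  note int' = abs_integral_weighted_le(1)[OF sets om(1) abs_omega_le_1[OF m'(1)] p''(1) p' p''(2)]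
  have fin_tail: "(LINT v:{t..b}|lborel. v * omega_series c F p (real m + 2) v) = real m * (?M t - ?M b)"
    if "b \<ge> t" for b
  proof -
    have per_measure: "(\<integral>r. (LINT v:{t..b}|lborel. v * omega (real m + 2) (v * r)) * p r \<partial>F n) =
        real m * ((\<integral>r. omega (real m) (t * r) * p' r \<partial>F n) - (\<integral>r. omega (real m) (b * r) * p' r \<partial>F n))" for n
    proof -
      have "(\<integral>r. (LINT v:{t..b}|lborel. v * omega (real m + 2) (v * r)) * p r \<partial>F n) =
        (\<integral>r. real m * (omega (real m) (t * r) * p' r - omega (real m) (b * r) * p' r) \<partial>F n)"
      proof (rule integral_cong_AE)
        show "AE r in F n. (LINT v:{t..b}|lborel. v * omega (real m + 2) (v * r)) * p r =
            real m * (omega (real m) (t * r) * p' r - omega (real m) (b * r) * p' r)"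
        proof (rule AE_mp[OF nz[of n]], intro AE_I2 impI)
          fix r :: real assume "r \<noteq> 0"
          thus "(LINT v:{t..b}|lborel. v * omega (real m + 2) (v * r)) * p r =
            real m * (omega (real m) (t * r) * p' r - omega (real m) (b * r) * p' r)"
            unfolding integral_linear_weight_omega[OF m'(2) \<open>r \<noteq> 0\<close> that] p'_def
            by (simp add: algebra_simps)
        qed
        have "(\<lambda>r. real m * (omega (real m) (t * r) * p' r - omega (real m) (b * r) * p' r)) \<in> borel_measurable (F n)"
          by (intro borel_measurable_integrable integrable_mult_right Bochner_Integration.integrable_diff int')
        thus "(\<lambda>r. real m * (omega (real m) (t * r) * p' r - omega (real m) (b * r) * p' r)) \<in> borel_measurable (F n)" .
        have [measurable]: "omega (real m + 2) \<in> borel_measurable borel" "p \<in> borel_measurable borel"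
          using om(2) p(1) by (auto intro: borel_measurable_continuous_onI)
        have "(\<lambda>r. (LINT v:{t..b}|lborel. v * omega (real m + 2) (v * r)) * p r) \<in> borel_measurable borel"
          unfolding set_lebesgue_integral_def by measurable
        thus "(\<lambda>r. (LINT v:{t..b}|lborel. v * omega (real m + 2) (v * r)) * p r) \<in> borel_measurable (F n)"
          by (rule measurable_from_restrict_borel[OF sets])
      qed
      also have "\<dots> = real m * ((\<integral>r. omega (real m) (t * r) * p' r \<partial>F n) - (\<integral>r. omega (real m) (b * r) * p' r \<partial>F n))"
        using int' by simp
      finally show ?thesis .
    qed
    have "(LINT v:{t..b}|lborel. v * omega_series c F p (real m + 2) v) =
        (\<Sum>n. c n * (\<integral>r. (LINT v:{t..b}|lborel. v * omega (real m + 2) (v * r)) * p r \<partial>F n))"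
      unfolding omega_series_def
      by (rule integral_series_swap[OF fin sets om(2) abs_omega_le_1[OF m'(3)] continuous_on_id p c])
    also have "\<dots> = (\<Sum>n. c n * (real m * ((\<integral>r. omega (real m) (t * r) * p' r \<partial>F n) - (\<integral>r. omega (real m) (b * r) * p' r \<partial>F n))))"
      by (simp only: per_measure)
    also have "\<dots> = (\<Sum>n. real m * (c n * (\<integral>r. omega (real m) (t * r) * p' r \<partial>F n) - c n * (\<integral>r. omega (real m) (b * r) * p' r \<partial>F n)))"
      by (simp add: algebra_simps)
    also have "\<dots> = real m * (?M t - ?M b)"
    proof -
      note sm = summable_omega_series[OF sets m'(1) p''(1) p' p''(2) c']
      show ?thesis
        unfolding suminf_mult[OF summable_diff[OF sm sm]] suminf_diff[OF sm sm, symmetric] omega_series_def ..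
    qed
    finally show ?thesis .
  qed
  let ?I = "LINT v:{t..}|lborel. v * omega_series c F p (real m + 2) v"
  have "((\<lambda>b. LINT v:{t..b}|lborel. v * omega_series c F p (real m + 2) v) \<longlongrightarrow> ?I) at_top"
    by (rule tendsto_set_lebesgue_integral_at_top[OF _ int]) simp
  hence "((\<lambda>b. real m * (?M t - ?M b)) \<longlongrightarrow> ?I) at_top"
    by (rule Lim_transform_eventually)
       (rule eventually_mono[OF eventually_ge_at_top[of t] fin_tail])
  hence "((\<lambda>b. ?M t - real m * (?M t - ?M b) / real m) \<longlongrightarrow> ?M t - ?I / real m) at_top"
    using m' by (intro tendsto_intros) auto
  hence "(?M \<longlongrightarrow> ?M t - ?I / real m) at_top" using m' by simp
  \<comment> \<open>convergence of the tail integral forces convergence of \<open>?M\<close> at infinity\<close>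
  hence "?M t - ?I / real m = 0"
    by (rule omega_series_limit_unique[OF fin sets m p''(1) p' p''(2) c' nz])
  thus ?thesis using m' by (simp add: field_simps)
qed

section \<open>The operator \<open>I\<^sub>2\<close>\<close>

lemma neg_moment_finite:
  assumes sets: "sets F = sets (restrict_space borel {0..})" and fin: "neg_moment F \<nu> < \<infinity>"
  shows "integrable F (\<lambda>r. 1 / r ^ (2 * \<nu>))" and "\<nu> > 0 \<Longrightarrow> AE r in F. r \<noteq> 0"
proof -
  have space: "space F = {0..}"
    using sets_eq_imp_space_eq[OF sets] by (simp add: space_restrict_space)
  have [measurable]: "(\<lambda>r. r) \<in> borel_measurable F"
    by (rule measurable_from_restrict_borel[OF sets]) simp
  show "integrable F (\<lambda>r. 1 / r ^ (2 * \<nu>))"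
  proof (rule integrableI_bounded)
    have "(\<integral>\<^sup>+r. ennreal (norm (1 / r ^ (2 * \<nu>))) \<partial>F) \<le> neg_moment F \<nu>"
      unfolding neg_moment_def
    proof (rule nn_integral_mono)
      fix r assume "r \<in> space F"
      show "ennreal (norm (1 / r ^ (2 * \<nu>))) \<le> 1 / ennreal (r ^ (2 * \<nu>))"
      proof (cases "r ^ (2 * \<nu>) = 0")
        case False
        have "r ^ (2 * \<nu>) \<ge> 0" by (simp add: power_mult)
        hence pos: "r ^ (2 * \<nu>) > 0" using False by (intro order_le_neq_trans) auto
        hence "ennreal (1 / r ^ (2 * \<nu>)) = ennreal 1 / ennreal (r ^ (2 * \<nu>))"
          by (subst divide_ennreal) auto
        thus ?thesis using pos by simp
      next
        case True
        show ?thesis unfolding True by simp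
      qed
    qed
    thus "(\<integral>\<^sup>+r. ennreal (norm (1 / r ^ (2 * \<nu>))) \<partial>F) < \<infinity>" using fin by (rule order_le_less_trans)
  qed measurable
  assume "\<nu> > 0"
  have "AE r in F. 1 / ennreal (r ^ (2 * \<nu>)) \<noteq> \<infinity>"
    using fin unfolding neg_moment_def by (intro nn_integral_PInf_AE) auto
  thus "AE r in F. r \<noteq> 0"
  proof (rule AE_mp, intro AE_I2 impI)
    fix r :: real assume "1 / ennreal (r ^ (2 * \<nu>)) \<noteq> \<infinity>"
    thus "r \<noteq> 0" using \<open>\<nu> > 0\<close> by (auto simp: zero_power)
  qed
qed

lemma g_fun_eq_integral_omega:
  assumes sets: "sets F = sets (restrict_space borel {0..})" and "2 * \<nu> < k" "t \<ge> 0"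
  shows "g_fun k F \<nu> t = (\<integral>r. omega (real (k - 2 * \<nu>)) (t * r) * (1 / r ^ (2 * \<nu>)) \<partial>F)"
proof -
  have space: "space F = {0..}"
    using sets_eq_imp_space_eq[OF sets] by (simp add: space_restrict_space)
  show ?thesis unfolding g_fun_def
    by (rule Bochner_Integration.integral_cong) (use assms space in \<open>auto simp: Omega_eq_omega\<close>)
qed

lemma pd_sphere_euclid_I2:
  assumes \<phi>: "\<phi> \<in> pd_sphere_euclid d (k + 2)" and "I2_defined \<phi>"
    and pos: "(LINT v:{0..}|lborel. v * \<phi> 1 v) > 0"
    and cont: "continuous_on ({-1..1} \<times> {0..}) (\<lambda>(x, t). I2 \<phi> x t)"
  shows "I2 \<phi> \<in> pd_sphere_euclid d k"
proof -
  define D where "D = (LINT v:{0..}|lborel. v * \<phi> 1 v)"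
  have D: "D > 0" using pos by (simp add: D_def)
  have "positive_definite_on (unit_sphere d \<times> euclid k)
    (\<lambda>(x, y) (x', y'). LINT v:{L2_set (\<lambda>i. y i - y' i) {..<k}..}|lborel. v * \<phi> (cos (geodesic_dist d x x')) v)"
    using assms(2) by (intro positive_definite_tail_integral[OF \<phi>]) (auto simp: I2_defined_def)
  note tail_pd = this[unfolded positive_definite_on_def, rule_format]
  have "positive_definite_on (unit_sphere d \<times> euclid k)
    (\<lambda>(x, y) (x', y'). I2 \<phi> (cos (geodesic_dist d x x')) (L2_set (\<lambda>i. y i - y' i) {..<k}))"
    unfolding positive_definite_on_def
  proof (intro allI impI)
    fix N :: nat and a :: "nat \<Rightarrow> real" and z :: "nat \<Rightarrow> (nat \<Rightarrow> real) \<times> (nat \<Rightarrow> real)"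
    let ?C = "\<lambda>(x, y) (x', y'). LINT v:{L2_set (\<lambda>i. y i - y' i) {..<k}..}|lborel. v * \<phi> (cos (geodesic_dist d x x')) v"
    assume "\<forall>i<N. z i \<in> unit_sphere d \<times> euclid k"
    hence "0 \<le> (\<Sum>i<N. \<Sum>j<N. a i * ?C (z i) (z j) * a j)" by (intro tail_pd) simp
    hence "0 \<le> (\<Sum>i<N. \<Sum>j<N. a i * ?C (z i) (z j) * a j) / D" using D by simp
    also have "\<dots> = (\<Sum>i<N. \<Sum>j<N. a i *
        (\<lambda>(x, y) (x', y'). I2 \<phi> (cos (geodesic_dist d x x')) (L2_set (\<lambda>i. y i - y' i) {..<k})) (z i) (z j) * a j)"
      by (simp add: sum_divide_distrib I2_def D_def split_def)
    finally show "0 \<le> (\<Sum>i<N. \<Sum>j<N. a i *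
        (\<lambda>(x, y) (x', y'). I2 \<phi> (cos (geodesic_dist d x x')) (L2_set (\<lambda>i. y i - y' i) {..<k})) (z i) (z j) * a j)" .
  qed
  thus ?thesis using cont by (simp add: pd_sphere_euclid_def)
qed

theorem theorem4p9:
  fixes d \<kappa> k :: nat
    and \<phi> :: "real \<Rightarrow> real \<Rightarrow> real"
    and f :: "nat \<Rightarrow> real \<Rightarrow> real"
    and F :: "nat \<Rightarrow> real measure"
  assumes "d \<ge> 1" and "\<kappa> \<ge> 1" and "k > 2 * \<kappa>"
    and "\<phi> \<in> pd_sphere_euclid d k"
    and "I2_power_defined \<kappa> \<phi>"
    and "schoenberg_functions d k \<phi> f"
    and "\<And>n. schoenberg_measure k (f n) (F n)"
    and "\<And>n \<nu>. \<nu> \<in> {1..\<kappa>} \<Longrightarrow> neg_moment (F n) \<nu> < \<infinity>"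
    and "\<And>\<nu>. \<nu> \<in> {1..\<kappa>} \<Longrightarrow>
           summable (\<lambda>n. g_fun k (F n) \<nu> 0 * gegenbauer ((real d - 1) / 2) n 1) \<and>
           (\<Sum>n. g_fun k (F n) \<nu> 0 * gegenbauer ((real d - 1) / 2) n 1) \<noteq> 0"
  shows "(\<forall>x\<in>{-1..1}. \<forall>t\<ge>0.
            summable (\<lambda>n. g_fun k (F n) \<kappa> t * gegenbauer ((real d - 1) / 2) n x) \<and>
            (I2 ^^ \<kappa>) \<phi> x t =
              1 / (\<Sum>n. g_fun k (F n) \<kappa> 0 * gegenbauer ((real d - 1) / 2) n 1) *
              (\<Sum>n. g_fun k (F n) \<kappa> t * gegenbauer ((real d - 1) / 2) n x)) \<and>
         (I2 ^^ \<kappa>) \<phi> \<in> pd_sphere_euclid d (k - 2 * \<kappa>)"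
proof -
  define C where "C n = gegenbauer ((real d - 1) / 2) n" for n
  define p where "p \<nu> r = 1 / r ^ (2 * \<nu>)" for \<nu> and r :: real
  define g where "g \<nu> n = g_fun k (F n) \<nu>" for \<nu> n
  define \<psi> where "\<psi> \<nu> x t = (\<Sum>n. g \<nu> n t * C n x)" for \<nu> x t
  have fin: "finite_measure (F n)" and sets: "sets (F n) = sets (restrict_space borel {0..})"
    and f_eq: "t \<ge> 0 \<Longrightarrow> f n t = (\<integral>r. Omega k (t * r) \<partial>F n)" for n t
    using assms(7)[of n] by (auto simp: schoenberg_measure_def)
  have p_meas: "p \<nu> \<in> borel_measurable borel" and p_nonneg: "p \<nu> r \<ge> 0" for \<nu> r
    by (auto simp: p_def[abs_def] power_mult)
  have p_int: "integrable (F n) (p \<nu>)" if "\<nu> \<le> \<kappa>" for n \<nu>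
  proof (cases "\<nu> = 0")
    case True
    thus ?thesis using finite_measure.integrable_const[OF fin, of n "1 :: real"] by (simp add: p_def[abs_def])
  next
    case False
    thus ?thesis using neg_moment_finite(1)[OF sets assms(8)] that by (simp add: p_def[abs_def])
  qed
  have nz: "AE r in F n. r \<noteq> 0" for n
    using neg_moment_finite(2)[OF sets assms(8)[of 1 n]] assms(2) by simp
  have g_eq: "g \<nu> n t = (\<integral>r. omega (real (k - 2 * \<nu>)) (t * r) * p \<nu> r \<partial>F n)" if "\<nu> \<le> \<kappa>" "t \<ge> 0" for \<nu> n t
    unfolding g_def p_def using that assms(3) by (intro g_fun_eq_integral_omega[OF sets]) auto
  have g_0: "g \<nu> n 0 = integral\<^sup>L (F n) (p \<nu>)" if "\<nu> \<le> \<kappa>" for \<nu> n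
    using g_eq[OF that, of 0] by simp
  have C_le: "\<bar>C n x\<bar> \<le> C n 1" if "x \<in> {-1..1}" for n x
    unfolding C_def using assms(1) that by (intro abs_gegenbauer_le) auto
  have C_nonneg: "C n 1 \<ge> 0" for n
    using C_le[of 1 n] by simp
  have f_g: "f n t = g 0 n t" if "t \<ge> 0" for n t
    using f_eq[OF that] by (simp add: g_def g_fun_def)
  have sum_1: "summable (\<lambda>n. C n 1 * integral\<^sup>L (F n) (p \<nu>))" if "\<nu> \<le> \<kappa>" for \<nu>
  proof (cases "\<nu> = 0")
    case True
    have "summable (\<lambda>n. f n 0 * C n 1)"
      using assms(6) by (simp add: schoenberg_functions_def C_def)
    thus ?thesis using True by (simp add: f_g g_0 mult.commute)
  next
    case False
    hence "summable (\<lambda>n. g \<nu> n 0 * C n 1)" using assms(9)[of \<nu>] that by (simp add: g_def C_def)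
    thus ?thesis using that by (simp add: g_0 mult.commute)
  qed
  have p_int_nonneg: "integral\<^sup>L (F n) (p \<nu>) \<ge> 0" for n \<nu>
    using p_nonneg by (intro integral_nonneg_AE) simp
  have sum_abs: "summable (\<lambda>n. \<bar>C n x\<bar> * integral\<^sup>L (F n) (p \<nu>))" if "\<nu> \<le> \<kappa>" "x \<in> {-1..1}" for \<nu> x
    by (rule summable_comparison_test'[OF sum_1[OF that(1)], of 0])
       (use C_le[OF that(2)] p_int_nonneg in \<open>simp add: abs_mult mult_right_mono\<close>)
  have dim: "real (k - 2 * \<nu>) \<ge> 1" if "\<nu> \<le> \<kappa>" for \<nu> using that assms(3) by simp
  have \<psi>_eq: "\<psi> \<nu> x t = omega_series (\<lambda>n. C n x) F (p \<nu>) (real (k - 2 * \<nu>)) t" if "\<nu> \<le> \<kappa>" "t \<ge> 0" for \<nu> x t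
    unfolding \<psi>_def omega_series_def using that by (simp add: g_eq mult.commute)
  have \<psi>_summable: "summable (\<lambda>n. g \<nu> n t * C n x)" if "\<nu> \<le> \<kappa>" "t \<ge> 0" "x \<in> {-1..1}" for \<nu> x t
    using summable_omega_series[OF sets dim[OF that(1)] p_meas p_int[OF that(1)] p_nonneg sum_abs[OF that(1,3)], of t]
    using that by (simp add: g_eq mult.commute)
  have \<psi>_cont: "continuous_on ({-1..1} \<times> {0..}) (\<lambda>(x, t). \<psi> \<nu> x t)" if "\<nu> \<le> \<kappa>" for \<nu>
  proof -
    let ?m = "real (k - 2 * \<nu>)"
    have om: "continuous_on UNIV (omega ?m)" using dim[OF that] by (intro continuous_intros) auto
    note q = om abs_omega_le_1[OF dim[OF that]] p_meas p_int[OF that] p_nonneg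
    let ?G = "\<lambda>n t. \<integral>r. omega ?m (t * r) * p \<nu> r \<partial>F n"
    have "continuous_on ({-1..1} \<times> {0..}) (\<lambda>z. \<Sum>n. C n (fst z) * ?G n (snd z))"
    proof (rule continuous_on_suminf[OF _ _ sum_1[OF that]])
      fix n
      show "continuous_on ({-1..1} \<times> {0..}) (\<lambda>z. C n (fst z) * ?G n (snd z))"
        unfolding C_def
        by (intro continuous_on_mult
              continuous_on_compose2[OF continuous_on_gegenbauer continuous_on_fst[OF continuous_on_id]]
              continuous_on_compose2[OF continuous_on_integral_weighted[OF sets q] continuous_on_snd[OF continuous_on_id]]) auto
      fix z :: "real \<times> real" assume "z \<in> {-1..1} \<times> {0..}"
      hence "fst z \<in> {-1..1}" by auto
      thus "\<bar>C n (fst z) * ?G n (snd z)\<bar> \<le> C n 1 * integral\<^sup>L (F n) (p \<nu>)"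
        unfolding abs_mult by (intro mult_mono C_le abs_integral_weighted_le(2)[OF sets q] C_nonneg) auto
    qed
    thus ?thesis
      by (rule continuous_on_eq) (auto simp: \<psi>_eq[OF that] omega_series_def)
  qed
  have \<psi>_pos: "\<psi> \<nu> 1 0 > 0" if "\<nu> \<in> {1..\<kappa>}" for \<nu>
  proof -
    have "\<psi> \<nu> 1 0 \<noteq> 0" using assms(9)[OF that] by (simp add: \<psi>_def g_def C_def)
    moreover have "\<psi> \<nu> 1 0 \<ge> 0"
      unfolding \<psi>_def using that C_nonneg p_int_nonneg
      by (intro suminf_nonneg \<psi>_summable) (auto simp: g_0)
    ultimately show ?thesis by simp
  qed
  \<comment> \<open>\<open>\<phi>\<close> itself is not normalised, its images under \<open>I2\<close> are\<close>
  define c where "c \<nu> = (if \<nu> = 0 then 1 else 1 / \<psi> \<nu> 1 0)" for \<nu>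
  have c_pos: "c \<nu> > 0" if "\<nu> \<le> \<kappa>" for \<nu>
    using \<psi>_pos[of \<nu>] that by (auto simp: c_def)
  have main: "(\<forall>x\<in>{-1..1}. \<forall>t\<ge>0. (I2 ^^ \<nu>) \<phi> x t = c \<nu> * \<psi> \<nu> x t) \<and>
      (I2 ^^ \<nu>) \<phi> \<in> pd_sphere_euclid d (k - 2 * \<nu>)" if "\<nu> \<le> \<kappa>" for \<nu>
    using that
  proof (induction \<nu>)
    case 0
    have "\<phi> x t = \<psi> 0 x t" if "x \<in> {-1..1}" "t \<ge> 0" for x t
    proof -
      have "(\<lambda>N. (\<lambda>(x, t). \<Sum>n<N. f n t * C n x) (x, t)) \<longlonglongrightarrow> (\<lambda>(x, t). \<phi> x t) (x, t)"
        by (rule tendsto_uniform_limitI[where S = "{-1..1} \<times> {0..}"])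
           (use assms(6) that in \<open>auto simp: schoenberg_functions_def C_def\<close>)
      hence "(\<lambda>n. f n t * C n x) sums \<phi> x t" by (simp add: sums_def)
      thus ?thesis using that by (simp add: \<psi>_def f_g sums_iff)
    qed
    thus ?case using assms(4) by (simp add: c_def)
  next
    case (Suc \<nu>)
    define \<phi>' where "\<phi>' = (I2 ^^ \<nu>) \<phi>"
    define m where "m = k - 2 * Suc \<nu>"
    have m: "m \<ge> 1" "k - 2 * \<nu> = m + 2" "real (k - 2 * \<nu>) = real m + 2" "real (k - 2 * Suc \<nu>) = real m"
      using Suc.prems assms(3) by (auto simp: m_def)
    have \<nu>: "\<nu> \<le> \<kappa>" using Suc.prems by simp
    have \<phi>': "\<phi>' x t = c \<nu> * \<psi> \<nu> x t" if "x \<in> {-1..1}" "t \<ge> 0" for x t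
      using Suc.IH[OF \<nu>] that by (simp add: \<phi>'_def)
    have \<phi>'_pd: "\<phi>' \<in> pd_sphere_euclid d (m + 2)"
      using Suc.IH[OF \<nu>] m by (simp add: \<phi>'_def)
    have def: "I2_defined \<phi>'"
      using assms(5) Suc.prems unfolding I2_power_defined_def \<phi>'_def by (auto dest: bspec[of _ _ "Suc \<nu>"])
    have p_Suc: "p (Suc \<nu>) = (\<lambda>r. p \<nu> r / r\<^sup>2)"
      by (simp add: p_def fun_eq_iff power2_eq_square)
    have tail: "(LINT v:{t..}|lborel. v * \<phi>' x v) = c \<nu> * (real m * \<psi> (Suc \<nu>) x t)"
      if xt: "x \<in> {-1..1}" "t \<ge> 0" for x t
    proof -
      let ?W = "omega_series (\<lambda>n. C n x) F (p \<nu>) (real m + 2)"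
      have eq: "v * \<phi>' x v = c \<nu> * (v * ?W v)" if "v \<in> {t..}" for v
      proof -
        have v: "v \<ge> 0" using that xt by simp
        show ?thesis
          unfolding \<phi>'[OF xt(1) v] \<psi>_eq[OF \<nu> v] m(3) by (rule mult.left_commute)
      qed
      have "set_integrable lborel {t..} (\<lambda>v. v * \<phi>' x v) \<longleftrightarrow>
          set_integrable lborel {t..} (\<lambda>v. c \<nu> * (v * ?W v))"
        by (intro set_integrable_cong refl eq)
      moreover have "set_integrable lborel {t..} (\<lambda>v. v * \<phi>' x v)"
        using def xt by (simp add: I2_defined_def)
      ultimately have "set_integrable lborel {t..} (\<lambda>v. c \<nu> * (v * ?W v))" by (rule iffD1)
      hence int: "set_integrable lborel {t..} (\<lambda>v. v * ?W v)"
        using c_pos[OF \<nu>] by simp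
      have "(LINT v:{t..}|lborel. v * \<phi>' x v) = (LINT v:{t..}|lborel. c \<nu> * (v * ?W v))"
        using eq by (intro set_lebesgue_integral_cong) auto
      also have "\<dots> = c \<nu> * (LINT v:{t..}|lborel. v * ?W v)" by simp
      also have "(LINT v:{t..}|lborel. v * ?W v) = real m * omega_series (\<lambda>n. C n x) F (p (Suc \<nu>)) (real m) t"
      proof -
        have "integrable (F n) (\<lambda>r. p \<nu> r / r\<^sup>2)" for n
          using p_int[OF Suc.prems, of n] by (simp only: p_Suc)
        moreover have "summable (\<lambda>n. \<bar>C n x\<bar> * integral\<^sup>L (F n) (\<lambda>r. p \<nu> r / r\<^sup>2))"
          using sum_abs[OF Suc.prems xt(1)] by (simp only: p_Suc)
        ultimately show ?thesis
          unfolding p_Suc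
          by (intro tail_integral_omega_series[where p = "p \<nu>" and c = "\<lambda>n. C n x" and F = F and m = m and t = t]
              fin sets m(1) p_meas p_int[OF \<nu>] p_nonneg sum_abs[OF \<nu> xt(1)] nz int)
      qed
      finally show ?thesis by (simp only: \<psi>_eq[OF Suc.prems xt(2)] m(4))
    qed
    have I2_eq: "I2 \<phi>' x t = c (Suc \<nu>) * \<psi> (Suc \<nu>) x t" if "x \<in> {-1..1}" "t \<ge> 0" for x t
      using tail[OF that] tail[of 1 0] c_pos[OF \<nu>] m(1) by (simp add: I2_def c_def)
    have "I2 \<phi>' \<in> pd_sphere_euclid d m"
    proof (rule pd_sphere_euclid_I2[OF \<phi>'_pd def])
      show "(LINT v:{0..}|lborel. v * \<phi>' 1 v) > 0"
        using tail[of 1 0] c_pos[OF \<nu>] \<psi>_pos[of "Suc \<nu>"] Suc.prems m(1) by simp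
      have "continuous_on ({-1..1} \<times> {0..}) (\<lambda>z. c (Suc \<nu>) * (case z of (x, t) \<Rightarrow> \<psi> (Suc \<nu>) x t))"
        by (intro continuous_on_mult_left \<psi>_cont Suc.prems)
      thus "continuous_on ({-1..1} \<times> {0..}) (\<lambda>(x, t). I2 \<phi>' x t)"
        by (rule continuous_on_eq) (auto simp: I2_eq)
    qed
    thus ?case using I2_eq by (simp add: \<phi>'_def m_def)
  qed
  have "c \<kappa> = 1 / \<psi> \<kappa> 1 0" using assms(2) by (simp add: c_def)
  thus ?thesis
    using main[of \<kappa>] \<psi>_summable[of \<kappa>] by (auto simp: \<psi>_def g_def C_def)
qed

end
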